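(* There exists a universal constant $C\in(0,\infty)$ such that the following holds. Let $k,m,n\in\mathbb{N}$, $\varepsilon\in(0,1)$ and $p\in(2,\infty)$. Let $A:\mathbb{R}^m\to\mathbb{R}^n$ be a (nonzero) linear operator that satisfies $k\le(1-\varepsilon)\,\mathrm{srank}_p(A)$. Then there exists a subset $\sigma\subseteq\{1,\ldots,m\}$ with $|\sigma|=k$ such that $$\|(AJ_\sigma)^{-1}\|_{S_\infty}\le C\left(1+\frac{p}{(p-2)\,|\log(1-\varepsilon^2)|}\right)^{1/2}\frac{\sqrt m}{\|A\|_{S_2}}.$$ Equivalently, there exists a universal constant $C'\in(0,\infty)$ such that for all $k,m,n\in\mathbb{N}$ and every (nonzero) linear operator $A:\mathbb{R}^m\to\mathbb{R}^n$, if $k<\mathrm{Entrank}(A)$ then there exists $\sigma\subseteq\{1,\ldots,m\}$ with $|\sigma|=k$ such that $$\|(AJ_\sigma)^{-1}\|_{S_\infty}\le C'\inf_{p>2}\psi_p\!\left(1-\frac{k}{\mathrm{srank}_p(A)}\right)\frac{\sqrt m}{\|A\|_{S_2}},$$ where, for $p\in(2,\infty)$, $\psi_p:\mathbb{R}\to[0,\infty]$ is defined by $\psi_p(\varepsilon)=\infty$ if $\varepsilon\le 0$; $\psi_p(\varepsilon)=\frac{1}{\varepsilon}\sqrt{\frac{p}{p-2}}$ if $0<\varepsilon\le\frac12$; $\psi_p(\varepsilon)=\frac{1}{\log(1/(1-\varepsilon))}\sqrt{\frac{p}{p-2}}$ if $\frac12<\varepsilon\le 1-e^{-p/(p-2)}$;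 and $\psi_p(\varepsilon)=1$ if $\varepsilon>1-e^{-p/(p-2)}$.
   Context: $\mathbb{N}=\{1,2,\ldots\}$; $\log$ is the natural logarithm; $e_1,\ldots,e_m$ is the standard basis of $\mathbb{R}^m$. For a linear operator $A:\mathbb{R}^m\to\mathbb{R}^n$, $s_1(A)\ge\cdots\ge s_m(A)\ge 0$ are its singular values, i.e. the eigenvalues, in decreasing order and with multiplicity, of $\sqrt{A^*A}$. For $p\in[1,\infty)$, $\|A\|_{S_p}=\big(\sum_{j=1}^m s_j(A)^p\big)^{1/p}$ is the Schatten--von Neumann $p$ norm, and $\|\cdot\|_{S_\infty}$ is the operator norm with respect to Euclidean norms. For $A\ne0$ and $p\in(2,\infty)$, the $p$-stable rank of $A$ is $\mathrm{srank}_p(A)=\big(\|A\|_{S_2}/\|A\|_{S_p}\big)^{2p/(p-2)}$; it is non-increasing in $p$. The entropic stable rank of $A$ is $$\mathrm{Entrank}(A)=\lim_{p\to2^+}\mathrm{srank}_p(A)=\exp\left(\log\sum_{j=1}^m s_j(A)^2-\frac{2\sum_{j=1}^m s_j(A)^2\log s_j(A)}{\sum_{j=1}^m s_j(A)^2}\right),$$ with the convention $0\log0=0$. For $\sigma\subseteq\{1,\ldots,m\}$, $J_\sigma:\mathbb{R}^\sigma\to\mathbb{R}^m$ is the inclusion $J_\sigma((a_j)_{j\in\sigma})=\sum_{j\in\sigma}a_je_j$. If $AJ_\sigma$ is injective, $(AJ_\sigma)^{-1}:A(\mathbb{R}^\sigma)\to\mathbb{R}^\sigma$ denotes the inverse of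 $AJ_\sigma$ defined on its image; if $AJ_\sigma$ is not injective, one sets $\|(AJ_\sigma)^{-1}\|_{S_\infty}=\infty$.
   Formalization: In the third case of ψ_p the factor 1/log(1/(1−ε)) is replaced by 1/√(log(1/(1−ε))); as printed the second claim fails for A=I_m, k=1, p/(p−2)=log m, m→∞. *)

theory Defs
  imports
    "Jordan_Normal_Form.Char_Poly"
    "HOL-Library.Extended_Real"
    Complex_Main
begin

text \<open>
  Linear operators from \<open>\<real>\<^sup>m\<close> to \<open>\<real>\<^sup>n\<close> are real matrices in \<open>carrier_mat n m\<close>, so that the
  dimensions can be quantified inside the scope of the universal constants.
  Coordinates are numbered from \<open>0\<close>, so the index set is \<open>{..<m}\<close>.
\<close>

definition vec_norm2 :: "real vec \<Rightarrow> real" where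
  "vec_norm2 v = sqrt (v \<bullet> v)"

definition psd_mat :: "real mat \<Rightarrow> bool" where
  "psd_mat M \<longleftrightarrow> square_mat M \<and> transpose_mat M = M \<and>
     (\<forall>v \<in> carrier_vec (dim_row M). 0 \<le> v \<bullet> (M *\<^sub>v v))"

definition psd_sqrt :: "real mat \<Rightarrow> real mat" where
  "psd_sqrt M = (THE B. psd_mat B \<and> B * B = M)"

text \<open>Since \<open>psd_sqrt (A\<^sup>T A)\<close> is real symmetric, its characteristic polynomial splits over the
  reals, so \<open>proots\<close> lists all its eigenvalues, with multiplicity.\<close>

definition singular_values :: "real mat \<Rightarrow> real list" where
  "singular_values A =
     rev (sorted_list_of_multiset (proots (char_poly (psd_sqrt (transpose_mat A * A)))))"

definition schatten_norm :: "real \<Rightarrow> real mat \<Rightarrow> real" where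
  "schatten_norm p A = (\<Sum>s\<leftarrow>singular_values A. s powr p) powr (1 / p)"

definition srank :: "real \<Rightarrow> real mat \<Rightarrow> real" where
  "srank p A = (schatten_norm 2 A / schatten_norm p A) powr (2 * p / (p - 2))"

definition entrank :: "real mat \<Rightarrow> real" where
  "entrank A = Lim (at_right 2) (\<lambda>p. srank p A)"

text \<open>The limit exists and has the closed form below (with \<open>0 * ln 0 = 0\<close>).\<close>

lemma srank_tendsto_entrank_formula:
  assumes "\<exists>s \<in> set (singular_values A). s \<noteq> 0"
  shows "((\<lambda>p. srank p A) \<longlongrightarrow>
      exp (ln (\<Sum>s\<leftarrow>singular_values A. s\<^sup>2)
        - 2 * (\<Sum>s\<leftarrow>singular_values A. s\<^sup>2 * ln s) / (\<Sum>s\<leftarrow>singular_values A. s\<^sup>2)))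
      (at_right 2)"
proof -
  define L where "L = singular_values A"
  define S where "S = (\<lambda>p::real. \<Sum>s\<leftarrow>L. s powr p)"
  have pos: "S p > 0" for p
  proof -
    from assms obtain s where s: "s \<in> set L" "s \<noteq> 0" unfolding L_def by blast
    have "s powr p \<le> S p" unfolding S_def
      by (rule member_le_sum_list) (use s in auto)
    moreover have "s powr p > 0" using s by simp
    ultimately show ?thesis by linarith
  qed
  have sq: "x powr 2 = x\<^sup>2" for x :: real
  proof -
    have "x powr 2 = \<bar>x\<bar> powr 2" by (simp add: powr_def abs_if ln_minus)
    also have "\<dots> = x\<^sup>2" by simp
    finally show ?thesis .
  qed
  define D where "D = (\<Sum>s\<leftarrow>L. s\<^sup>2 * ln s)"
  have "((\<lambda>p. \<Sum>s\<leftarrow>xs. s powr p) has_real_derivative (\<Sum>s\<leftarrow>xs. s\<^sup>2 * ln s)) (at 2)" for xs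
  proof (induction xs)
    case (Cons x xs)
    have "((\<lambda>p. x powr p) has_real_derivative x\<^sup>2 * ln x) (at 2)"
    proof (cases "x = 0")
      case False
      have "((\<lambda>p. exp (p * ln x)) has_real_derivative exp (2 * ln x) * ln x) (at 2)"
        by (auto intro!: derivative_eq_intros)
      moreover have "exp (2 * ln x) = x\<^sup>2" using sq[of x] False by (simp add: powr_def)
      ultimately show ?thesis using False by (simp add: powr_def)
    qed simp
    from DERIV_add[OF this Cons.IH] show ?case by simp
  qed simp
  then have dS: "(S has_real_derivative D) (at 2)" unfolding S_def D_def .
  define h where "h = (\<lambda>p. p * ln (S 2) - 2 * ln (S p))"
  have "(h has_real_derivative ln (S 2) - 2 * D / S 2) (at 2)"
    unfolding h_def using pos[of 2]
    by (auto intro!: derivative_eq_intros dS simp: field_simps)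
  then have "((\<lambda>p. (h p - h 2) / (p - 2)) \<longlongrightarrow> ln (S 2) - 2 * D / S 2) (at_right 2)"
    unfolding has_field_derivative_iff by (rule filterlim_mono) (auto simp: at_le)
  then have "((\<lambda>p. exp ((h p - h 2) / (p - 2))) \<longlongrightarrow> exp (ln (S 2) - 2 * D / S 2)) (at_right 2)"
    by (rule tendsto_exp)
  moreover have "eventually (\<lambda>p. exp ((h p - h 2) / (p - 2)) = srank p A) (at_right 2)"
    unfolding eventually_at_right_field
  proof (intro exI[of _ 3] conjI allI impI)
    fix p :: real assume p: "2 < p"
    have sch: "schatten_norm q A = S q powr (1 / q)" for q
      by (simp add: schatten_norm_def S_def L_def)
    have "srank p A = exp (2 * p / (p - 2) * (1 / 2 * ln (S 2) - 1 / p * ln (S p)))"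
      unfolding srank_def sch using pos[of 2] pos[of p]
      by (simp add: powr_def ln_div flip: exp_diff)
    also have "2 * p / (p - 2) * (1 / 2 * ln (S 2) - 1 / p * ln (S p)) = (h p - h 2) / (p - 2)"
      using p unfolding h_def by (simp add: field_simps)
    finally show "exp ((h p - h 2) / (p - 2)) = srank p A" by simp
  qed simp
  ultimately have "((\<lambda>p. srank p A) \<longlongrightarrow> exp (ln (S 2) - 2 * D / S 2)) (at_right 2)"
    by (rule Lim_transform_eventually)
  then show ?thesis unfolding S_def D_def L_def sq .
qed

corollary entrank_formula:
  assumes "\<exists>s \<in> set (singular_values A). s \<noteq> 0"
  shows "entrank A =
      exp (ln (\<Sum>s\<leftarrow>singular_values A. s\<^sup>2)
        - 2 * (\<Sum>s\<leftarrow>singular_values A. s\<^sup>2 * ln s) / (\<Sum>s\<leftarrow>singular_values A. s\<^sup>2))"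
  unfolding entrank_def
  by (intro tendsto_Lim srank_tendsto_entrank_formula assms) simp

text \<open>The space \<open>\<real>\<^sup>\<sigma>\<close> consists of the functions that are \<open>undefined\<close> off \<open>\<sigma>\<close>.\<close>

abbreviation coord_space :: "nat set \<Rightarrow> (nat \<Rightarrow> real) set" where
  "coord_space \<sigma> \<equiv> \<sigma> \<rightarrow>\<^sub>E UNIV"

definition coord_norm2 :: "nat set \<Rightarrow> (nat \<Rightarrow> real) \<Rightarrow> real" where
  "coord_norm2 \<sigma> a = sqrt (\<Sum>j\<in>\<sigma>. (a j)\<^sup>2)"

definition coord_incl :: "nat \<Rightarrow> nat set \<Rightarrow> (nat \<Rightarrow> real) \<Rightarrow> real vec" where
  "coord_incl m \<sigma> a = vec m (\<lambda>j. if j \<in> \<sigma> then a j else 0)"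

definition restrict_op :: "real mat \<Rightarrow> nat set \<Rightarrow> (nat \<Rightarrow> real) \<Rightarrow> real vec" where
  "restrict_op A \<sigma> a = A *\<^sub>v coord_incl (dim_col A) \<sigma> a"

text \<open>The norm of \<open>(A J\<^sub>\<sigma>)\<^sup>-\<^sup>1\<close>, as a supremum over the unit ball of the image of \<open>A J\<^sub>\<sigma>\<close>.\<close>

definition inv_restrict_norm :: "real mat \<Rightarrow> nat set \<Rightarrow> ereal" where
  "inv_restrict_norm A \<sigma> =
     (if inj_on (restrict_op A \<sigma>) (coord_space \<sigma>)
      then SUP y \<in> {y \<in> restrict_op A \<sigma> ` coord_space \<sigma>. vec_norm2 y \<le> 1}.
             ereal (coord_norm2 \<sigma> (inv_into (coord_space \<sigma>) (restrict_op A \<sigma>) y))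
      else \<infinity>)"

text \<open>In the third case the logarithm stands under the square root. This makes \<open>\<psi>\<^sub>p\<close> continuous at
  \<open>1 - exp (- p / (p - 2))\<close> and bounded below by \<open>1\<close>. With the logarithm outside the root the
  resulting inequality fails for the identity matrix: take \<open>k = 1\<close>, \<open>p / (p - 2) = ln m\<close> and let
  \<open>m\<close> tend to infinity; the left-hand side is \<open>1\<close>, the right-hand side a multiple of
  \<open>1 / sqrt (ln m)\<close>.\<close>

definition psi :: "real \<Rightarrow> real \<Rightarrow> ereal" where
  "psi p \<epsilon> =
     (if \<epsilon> \<le> 0 then \<infinity>
      else if \<epsilon> \<le> 1 / 2 then ereal (1 / \<epsilon> * sqrt (p / (p - 2)))
      else if \<epsilon> \<le> 1 - exp (- (p / (p - 2)))
        then ereal (1 / sqrt (ln (1 / (1 - \<epsilon>))) * sqrt (p / (p - 2)))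
      else 1)"

end

theory Submission
  imports Defs
begin

text \<open>
  Let \<open>G = A\<^sup>T A\<close> have the eigenvalues \<open>d\<^sub>i\<close>. For \<open>s > 0\<close>, start with the barrier \<open>b = - s\<close> below the
  spectrum of \<open>G\<close> and with \<open>U = (\<Sum>i. 1 / (d\<^sub>i + s))\<close>. One can delete a row and the corresponding
  column so that, after raising \<open>b\<close> by \<open>1 / U\<close>, the eigenvalues stay above \<open>b\<close> and the sum
  of the \<open>1 / (\<lambda> - b)\<close> stays at most \<open>U\<close>. After \<open>m - k\<close> deletions the \<open>k\<close> remaining columns
  have a Gram matrix with smallest eigenvalue above \<open>- s + (m - k) / U\<close>, which is at least
  \<open>s (N - k) / m\<close> with \<open>N = (\<Sum>i. d\<^sub>i / (d\<^sub>i + s))\<close>. It remains to choose \<open>s\<close>. In terms of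
  \<open>V\<^sub>i = k d\<^sub>i / (\<Sum>j. d\<^sub>j)\<close>, with \<open>i\<close> drawn with probability proportional to \<open>d\<^sub>i\<close>, the hypothesis on
  the stable rank says that the moment of order \<open>(p - 2) / 2\<close> of \<open>V\<close> is small, and a pointwise
  inequality turns this into a lower bound for the expectation of \<open>1 / (V + \<theta>)\<close>, that is, for
  \<open>N\<close>, with \<open>s\<close> proportional to \<open>\<theta>\<close>. The second part follows from the first by applying it to every
  \<open>p\<close> with \<open>srank p A > k\<close>: there are only finitely many sets \<open>\<sigma>\<close>, so one of them works for
  all \<open>p\<close>.
\<close>

section \<open>Spectral theorem for real symmetric matrices\<close>

lemma mult_mat_diag_vec_index:
  assumes "v \<in> carrier_vec n" "i < n"
  shows "(mat_diag n d *\<^sub>v v) $ i = d i * v $ i"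
proof -
  have "(mat_diag n d *\<^sub>v v) $ i = (\<Sum>j<n. (if i = j then d j else 0) * v $ j)"
    using assms by (simp add: mat_diag_def scalar_prod_def atLeast0LessThan)
  also have "\<dots> = (\<Sum>j<n. if i = j then d j * v $ j else 0)"
    by (intro sum.cong) auto
  finally show ?thesis using assms by simp
qed

lemma scalar_prod_mult_mat_vec_transpose:
  fixes M :: "'a::comm_semiring_0 mat"
  assumes "M \<in> carrier_mat n m" "v \<in> carrier_vec n" "w \<in> carrier_vec m"
  shows "v \<bullet> (M *\<^sub>v w) = (M\<^sup>T *\<^sub>v v) \<bullet> w"
proof -
  have "v \<bullet> (M *\<^sub>v w) = (\<Sum>i<n. \<Sum>j<m. v $ i * (M $$ (i,j) * w $ j))"
    using assms by (simp add: scalar_prod_def atLeast0LessThan sum_distrib_left)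
  also have "\<dots> = (\<Sum>j<m. \<Sum>i<n. v $ i * (M $$ (i,j) * w $ j))"
    by (rule sum.swap)
  also have "\<dots> = (M\<^sup>T *\<^sub>v v) \<bullet> w"
    using assms by (auto simp: scalar_prod_def atLeast0LessThan sum_distrib_left
        sum_distrib_right ac_simps intro!: sum.cong)
  finally show ?thesis .
qed

lemma scalar_prod_self_pos:
  fixes v :: "real vec"
  assumes "v \<in> carrier_vec n" "v \<noteq> 0\<^sub>v n"
  shows "0 < v \<bullet> v"
proof -
  have "\<exists>i<n. v $ i \<noteq> 0" using assms by (metis carrier_vecD dim_vec eq_vecI index_zero_vec(1) zero_carrier_vec)
  then obtain i where "i < n" "v $ i \<noteq> 0" by blast
  then have "0 < (\<Sum>i<n. v $ i * v $ i)"
    by (intro sum_pos2[of _ i]) (auto simp: zero_less_mult_iff linorder_neq_iff)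
  then show ?thesis using assms by (simp add: scalar_prod_def atLeast0LessThan)
qed

lemma scalar_prod_self_nonneg: "0 \<le> v \<bullet> v" for v :: "real vec"
  by (simp add: scalar_prod_def sum_nonneg)

text \<open>Over the complex numbers an eigenvector \<open>w = x + i y\<close> exists because the
  characteristic polynomial splits. Computing \<open>y \<bullet> (M *\<^sub>v x)\<close> in two ways
  makes \<open>Im z * (x \<bullet> x + y \<bullet> y)\<close> vanish. So the eigenvalue is real, and
  whichever of \<open>x\<close>, \<open>y\<close> is nonzero is a real eigenvector.\<close>

lemma real_symmetric_eigenvector:
  fixes M :: "real mat"
  assumes M: "M \<in> carrier_mat n n" and sym: "M\<^sup>T = M" and n: "0 < n"
  obtains v r where "v \<in> carrier_vec n" "v \<noteq> 0\<^sub>v n" "M *\<^sub>v v = r \<cdot>\<^sub>v v"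
proof -
  define Mc where "Mc = map_mat complex_of_real M"
  have Mc: "Mc \<in> carrier_mat n n" unfolding Mc_def using M by simp
  obtain as where as: "char_poly Mc = (\<Prod>a\<leftarrow>as. [:- a, 1:])" "length as = n"
    using char_poly_factorized[OF Mc] by blast
  then obtain z where "z \<in> set as" using n by (cases as) auto
  then have "poly (char_poly Mc) z = 0" unfolding as by (simp add: poly_prod_list prod_list_zero_iff image_iff)
  then have "eigenvalue Mc z" using eigenvalue_root_char_poly[OF Mc] by simp
  then obtain w where w: "w \<in> carrier_vec n" "w \<noteq> 0\<^sub>v n" "Mc *\<^sub>v w = z \<cdot>\<^sub>v w"
    using Mc unfolding eigenvalue_def eigenvector_def by auto
  define x y where "x = map_vec Re w" and "y = map_vec Im w"
  have xy: "x \<in> carrier_vec n" "y \<in> carrier_vec n" unfolding x_def y_def using w by auto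
  have row: "(\<Sum>j<n. complex_of_real (M $$ (i,j)) * w $ j) = z * w $ i" if "i < n" for i
  proof -
    have "(Mc *\<^sub>v w) $ i = (z \<cdot>\<^sub>v w) $ i" using w by simp
    then show ?thesis using that w(1) M by (simp add: Mc_def scalar_prod_def atLeast0LessThan)
  qed
  have Mx: "M *\<^sub>v x = Re z \<cdot>\<^sub>v x - Im z \<cdot>\<^sub>v y"
  proof (rule eq_vecI)
    fix i assume "i < dim_vec (Re z \<cdot>\<^sub>v x - Im z \<cdot>\<^sub>v y)"
    then have i: "i < n" using xy by simp
    show "(M *\<^sub>v x) $ i = (Re z \<cdot>\<^sub>v x - Im z \<cdot>\<^sub>v y) $ i"
      using arg_cong[OF row[OF i], of Re] i w(1) M
      by (simp add: scalar_prod_def atLeast0LessThan x_def y_def)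
  qed (use xy M in auto)
  have My: "M *\<^sub>v y = Re z \<cdot>\<^sub>v y + Im z \<cdot>\<^sub>v x"
  proof (rule eq_vecI)
    fix i assume "i < dim_vec (Re z \<cdot>\<^sub>v y + Im z \<cdot>\<^sub>v x)"
    then have i: "i < n" using xy by simp
    show "(M *\<^sub>v y) $ i = (Re z \<cdot>\<^sub>v y + Im z \<cdot>\<^sub>v x) $ i"
      using arg_cong[OF row[OF i], of Im] i w(1) M
      by (simp add: scalar_prod_def atLeast0LessThan x_def y_def)
  qed (use xy M in auto)
  have nz: "x \<noteq> 0\<^sub>v n \<or> y \<noteq> 0\<^sub>v n"
  proof (rule ccontr)
    assume "\<not> ?thesis"
    then have *: "x = 0\<^sub>v n" "y = 0\<^sub>v n" by auto
    have "w $ i = 0" if "i < n" for i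
      using arg_cong[OF *(1), of "\<lambda>v. v $ i"] arg_cong[OF *(2), of "\<lambda>v. v $ i"] that w(1)
      by (simp add: x_def y_def complex_eq_iff)
    then have "w = 0\<^sub>v n" using w(1) by (intro eq_vecI) auto
    then show False using w by simp
  qed
  have "y \<bullet> (M *\<^sub>v x) = (M *\<^sub>v y) \<bullet> x"
    using scalar_prod_mult_mat_vec_transpose[OF M xy(2) xy(1)] sym by simp
  moreover have "y \<bullet> (M *\<^sub>v x) = Re z * (y \<bullet> x) - Im z * (y \<bullet> y)"
    unfolding Mx using xy by (subst scalar_prod_minus_distrib[of _ n]) auto
  moreover have "(M *\<^sub>v y) \<bullet> x = Re z * (y \<bullet> x) + Im z * (x \<bullet> x)"
    unfolding My using xy by (subst add_scalar_prod_distrib[of _ n]) auto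
  ultimately have "Im z * (x \<bullet> x + y \<bullet> y) = 0" by (simp add: algebra_simps)
  moreover have "x \<bullet> x + y \<bullet> y > 0"
    using nz scalar_prod_self_pos[OF xy(1)] scalar_prod_self_pos[OF xy(2)]
      scalar_prod_self_nonneg[of x] scalar_prod_self_nonneg[of y] by (smt (verit))
  ultimately have "Im z = 0" by auto
  then have "M *\<^sub>v x = Re z \<cdot>\<^sub>v x" "M *\<^sub>v y = Re z \<cdot>\<^sub>v y"
    using Mx My xy by (auto intro!: eq_vecI)
  then show thesis using that nz xy by blast
qed

text \<open>Reflecting in the hyperplane orthogonal to \<open>w = q - unit_vec n 0\<close> exchanges
  the two unit vectors. The reflection is its own transpose and inverse. For
  \<open>q = unit_vec n 0\<close>, where \<open>w\<close> vanishes, the identity serves.\<close>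

lemma householder:
  fixes q :: "real vec"
  assumes q: "q \<in> carrier_vec n" and qq: "q \<bullet> q = 1" and n: "0 < n"
  obtains H where "H \<in> carrier_mat n n" "H\<^sup>T = H" "H * H = 1\<^sub>m n" "H *\<^sub>v unit_vec n 0 = q"
proof (cases "q = unit_vec n 0")
  case True
  show thesis by (rule that[of "1\<^sub>m n"]) (use True in auto)
next
  case False
  define w where "w = q - unit_vec n 0"
  have w: "w \<in> carrier_vec n" unfolding w_def using q by simp
  have "w \<noteq> 0\<^sub>v n"
  proof
    assume *: "w = 0\<^sub>v n"
    have "q $ i = unit_vec n 0 $ i" if "i < n" for i
      using arg_cong[OF *, of "\<lambda>v. v $ i"] that q by (simp add: w_def)
    then have "q = unit_vec n 0" using q by (intro eq_vecI) auto
    then show False using False by simp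
  qed
  then have ww: "w \<bullet> w > 0" using scalar_prod_self_pos[OF w] by simp
  have "w \<bullet> w = q \<bullet> w - unit_vec n 0 \<bullet> w"
    using q w by (subst w_def, subst minus_scalar_prod_distrib[of _ n]) auto
  also have "q \<bullet> w = 1 - q $ 0"
    unfolding w_def using q qq n by (subst scalar_prod_minus_distrib[of _ n]) auto
  also have "unit_vec n 0 \<bullet> w = q $ 0 - 1"
    using w n q by (simp add: w_def)
  finally have ww2: "w \<bullet> w = 2 - 2 * q $ 0" by simp
  define c where "c = 2 / (w \<bullet> w)"
  define H where "H = mat n n (\<lambda>(i,j). (if i = j then 1 else 0) - c * (w $ i * w $ j))"
  have H: "H \<in> carrier_mat n n" unfolding H_def by simp
  have HH: "H * H = 1\<^sub>m n"
  proof (rule eq_matI)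
    fix i j assume "i < dim_row (1\<^sub>m n :: real mat)" "j < dim_col (1\<^sub>m n :: real mat)"
    then have ij: "i < n" "j < n" by auto
    have "(H * H) $$ (i,j) = (\<Sum>k<n. ((if i = k then 1 else 0) - c * (w $ i * w $ k)) *
         ((if k = j then 1 else 0) - c * (w $ k * w $ j)))"
      using ij by (simp add: H_def scalar_prod_def atLeast0LessThan)
    also have "\<dots> = (\<Sum>k<n. (if i = k then (if k = j then 1 else 0) - c * (w $ k * w $ j) else 0)
        - (if k = j then c * (w $ i * w $ k) else 0) + c * c * w $ i * w $ j * (w $ k * w $ k))"
      by (intro sum.cong) (auto simp: algebra_simps)
    also have "\<dots> = (if i = j then 1 else 0) - 2 * c * (w $ i * w $ j)
        + c * c * w $ i * w $ j * (w \<bullet> w)"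
      using ij w by (simp add: sum.distrib sum_subtractf sum_distrib_left[symmetric]
          scalar_prod_def atLeast0LessThan mult.assoc)
    also have "\<dots> = (if i = j then 1 else 0)"
      using ww by (simp add: c_def power2_eq_square field_simps)
    finally show "(H * H) $$ (i,j) = 1\<^sub>m n $$ (i,j)" using ij by simp
  qed (use H in auto)
  have He: "H *\<^sub>v unit_vec n 0 = q"
  proof (rule eq_vecI)
    fix i assume "i < dim_vec q"
    then have i: "i < n" using q by simp
    have "(H *\<^sub>v unit_vec n 0) $ i = H $$ (i,0)"
      using i n H by simp
    also have "\<dots> = (if i = 0 then 1 else 0) - c * (w $ i * w $ 0)"
      using i n by (simp add: H_def)
    also have "c * (w $ i * w $ 0) = - w $ i"
    proof -
      have "w $ 0 = - (w \<bullet> w) / 2" unfolding ww2 using n q by (simp add: w_def)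
      then have "c * (w $ i * w $ 0) = 2 / (w \<bullet> w) * (w $ i * (- (w \<bullet> w) / 2))"
        unfolding c_def by (rule arg_cong)
      then show ?thesis using ww by simp
    qed
    also have "(if i = 0 then 1 else 0) - (- w $ i) = q $ i"
      using i n q by (auto simp: w_def)
    finally show "(H *\<^sub>v unit_vec n 0) $ i = q $ i" .
  qed (use H q in auto)
  have HT: "H\<^sup>T = H" unfolding H_def by (rule eq_matI) (auto simp: ac_simps)
  show thesis by (rule that[OF H HT HH He])
qed

text \<open>Induction on the dimension by deflation. A Householder reflection sends the first basis
  vector to a unit eigenvector; after conjugation the first column is \<open>r\<close> times that
  basis vector, symmetry clears the first row, and the induction hypothesis diagonalises the
  remaining symmetric block.\<close>

theorem real_spectral_theorem:
  fixes M :: "real mat"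
  assumes "M \<in> carrier_mat n n" "M\<^sup>T = M"
  obtains Q d where "Q \<in> carrier_mat n n" "Q\<^sup>T * Q = 1\<^sub>m n" "M = Q * mat_diag n d * Q\<^sup>T"
  using assms
proof (induction n arbitrary: M thesis)
  case 0
  show ?case by (rule 0(1)[of "1\<^sub>m 0"]) (use 0 in \<open>auto intro!: eq_matI\<close>)
next
  case (Suc n)
  note M = Suc.prems(2) and sym = Suc.prems(3)
  obtain v r where v: "v \<in> carrier_vec (Suc n)" "v \<noteq> 0\<^sub>v (Suc n)" "M *\<^sub>v v = r \<cdot>\<^sub>v v"
    using real_symmetric_eigenvector[OF M sym] by auto
  have vv: "v \<bullet> v > 0" using scalar_prod_self_pos v by blast
  define q where "q = (1 / sqrt (v \<bullet> v)) \<cdot>\<^sub>v v"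
  have q: "q \<in> carrier_vec (Suc n)" unfolding q_def using v by simp
  have qq: "q \<bullet> q = 1" unfolding q_def using vv by (simp add: power2_eq_square[symmetric])
  have Mq: "M *\<^sub>v q = r \<cdot>\<^sub>v q" unfolding q_def using v M
    by (simp add: mult_mat_vec[of _ _ "Suc n"] smult_smult_assoc ac_simps)
  obtain H where H: "H \<in> carrier_mat (Suc n) (Suc n)" "H\<^sup>T = H" "H * H = 1\<^sub>m (Suc n)"
      "H *\<^sub>v unit_vec (Suc n) 0 = q"
    using householder[OF q qq] by auto
  define B where "B = H * M * H"
  have B: "B \<in> carrier_mat (Suc n) (Suc n)" unfolding B_def using H M by simp
  have Bsym: "B\<^sup>T = B"
  proof -
    have "B\<^sup>T = H\<^sup>T * (H * M)\<^sup>T" unfolding B_def using H M by (intro transpose_mult) auto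
    also have "(H * M)\<^sup>T = M\<^sup>T * H\<^sup>T" using H M by (intro transpose_mult) auto
    also have "H\<^sup>T * (M\<^sup>T * H\<^sup>T) = B" unfolding B_def H sym
      using H M by (simp add: assoc_mult_mat[of _ "Suc n" "Suc n" _ "Suc n" _ "Suc n"])
    finally show ?thesis .
  qed
  have "B *\<^sub>v unit_vec (Suc n) 0 = H *\<^sub>v (M *\<^sub>v q)"
    unfolding B_def using H M by (simp add: assoc_mult_mat_vec[of _ "Suc n" "Suc n" _ "Suc n"])
  also have "\<dots> = r \<cdot>\<^sub>v (H *\<^sub>v q)" unfolding Mq using H q by (simp add: mult_mat_vec)
  also have "H *\<^sub>v q = (H * H) *\<^sub>v unit_vec (Suc n) 0"
    using H(1) by (simp add: assoc_mult_mat_vec[of _ "Suc n" "Suc n" _ "Suc n"] flip: H(4))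
  also have "\<dots> = unit_vec (Suc n) 0" by (simp add: H)
  finally have Be: "B *\<^sub>v unit_vec (Suc n) 0 = r \<cdot>\<^sub>v unit_vec (Suc n) 0" .
  have B0: "B $$ (i,0) = (if i = 0 then r else 0)" if "i < Suc n" for i
    using arg_cong[OF Be, of "\<lambda>v. v $ i"] that B by auto
  have B0': "B $$ (0,i) = (if i = 0 then r else 0)" if "i < Suc n" for i
    using B0[OF that] arg_cong[OF Bsym, of "\<lambda>M. M $$ (0,i)"] that B by auto
  define C where "C = mat n n (\<lambda>(i,j). B $$ (Suc i, Suc j))"
  have C: "C \<in> carrier_mat n n" unfolding C_def by simp
  have Csym: "C\<^sup>T = C"
  proof (rule eq_matI)
    fix i j assume "i < dim_row C" "j < dim_col C"
    then show "C\<^sup>T $$ (i,j) = C $$ (i,j)"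
      using arg_cong[OF Bsym, of "\<lambda>M. M $$ (Suc i,Suc j)"] B by (simp add: C_def)
  qed (use C in auto)
  obtain Q d where Q: "Q \<in> carrier_mat n n" "Q\<^sup>T * Q = 1\<^sub>m n" "C = Q * mat_diag n d * Q\<^sup>T"
    using Suc.IH[OF _ C Csym] by blast
  \<comment> \<open>\<open>K\<close> extends the diagonalising matrix of the block by a leading
    \<open>1\<close>, and \<open>e\<close> puts the new eigenvalue \<open>r\<close> at index
    \<open>0\<close>, shifting the others by one.\<close>
  define K where "K = four_block_mat (1\<^sub>m 1) (0\<^sub>m 1 n) (0\<^sub>m n 1) Q"
  define e where "e = case_nat r d"
  have K: "K \<in> carrier_mat (Suc n) (Suc n)" unfolding K_def using Q by auto
  have KT: "K\<^sup>T = four_block_mat (1\<^sub>m 1) (0\<^sub>m 1 n) (0\<^sub>m n 1) (Q\<^sup>T)"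
    unfolding K_def using Q by (subst transpose_four_block_mat[of _ 1 1 _ n _ n]) auto
  have KK: "K\<^sup>T * K = 1\<^sub>m (Suc n)"
    unfolding KT unfolding K_def using Q by (subst mult_four_block_mat[of _ 1 1 _ n _ n _ _ 1 _ n]) auto
  have De: "mat_diag (Suc n) e = four_block_mat (mat_diag 1 (\<lambda>_. r)) (0\<^sub>m 1 n) (0\<^sub>m n 1) (mat_diag n d)"
    by (rule eq_matI) (auto simp: mat_diag_def e_def split: nat.splits)
  have KDK: "K * mat_diag (Suc n) e * K\<^sup>T = four_block_mat (mat_diag 1 (\<lambda>_. r)) (0\<^sub>m 1 n) (0\<^sub>m n 1) C"
  proof -
    have z: "0\<^sub>m (Suc 0) n * mat_diag n d = 0\<^sub>m (Suc 0) n"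
        "1\<^sub>m (Suc 0) * mat_diag (Suc 0) (\<lambda>_. r) = mat_diag (Suc 0) (\<lambda>_. r)"
        "0\<^sub>m n (Suc 0) * mat_diag (Suc 0) (\<lambda>_. r) = 0\<^sub>m n (Suc 0)"
        "mat_diag (Suc 0) (\<lambda>_. r) * 1\<^sub>m (Suc 0) = mat_diag (Suc 0) (\<lambda>_. r)"
        "mat_diag (Suc 0) (\<lambda>_. r) * 0\<^sub>m (Suc 0) n = 0\<^sub>m (Suc 0) n"
        "mat_diag (Suc 0) (\<lambda>_. r) + 0\<^sub>m (Suc 0) (Suc 0) = mat_diag (Suc 0) (\<lambda>_. r)"
      using left_mult_zero_mat[OF mat_diag_dim, of "Suc 0" n d] left_mult_one_mat[OF mat_diag_dim]
        left_mult_zero_mat[OF mat_diag_dim, of n "Suc 0"] right_add_zero_mat[OF mat_diag_dim]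
        right_mult_one_mat[OF mat_diag_dim] right_mult_zero_mat[OF mat_diag_dim]
      by auto
    have "Q * mat_diag n d * 0\<^sub>m n (Suc 0) = 0\<^sub>m n (Suc 0)"
      using Q by (intro right_mult_zero_mat) simp
    moreover have "0\<^sub>m n n + Q * mat_diag n d * Q\<^sup>T = Q * mat_diag n d * Q\<^sup>T"
      using Q by (intro left_add_zero_mat mult_carrier_mat[of _ n n]) auto
    note z = z calculation this
    have "K * mat_diag (Suc n) e =
        four_block_mat (mat_diag 1 (\<lambda>_. r)) (0\<^sub>m 1 n) (0\<^sub>m n 1) (Q * mat_diag n d)"
      unfolding De K_def using Q
      by (subst mult_four_block_mat[of _ 1 1 _ n _ n _ _ 1 _ n]) (simp_all add: z)
    moreover have "four_block_mat (mat_diag 1 (\<lambda>_. r)) (0\<^sub>m 1 n) (0\<^sub>m n 1) (Q * mat_diag n d) * K\<^sup>T =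
        four_block_mat (mat_diag 1 (\<lambda>_. r)) (0\<^sub>m 1 n) (0\<^sub>m n 1) C"
      unfolding KT using Q
      by (subst mult_four_block_mat[of _ 1 1 _ n _ n _ _ 1 _ n]) (simp_all add: z)
    ultimately show ?thesis by simp
  qed
  also have "\<dots> = B"
    by (rule eq_matI) (use B B0 B0' C in \<open>auto simp: C_def mat_diag_def Suc_diff_Suc\<close>)
  finally have BK: "B = K * mat_diag (Suc n) e * K\<^sup>T" by simp
  have HK: "H * K \<in> carrier_mat (Suc n) (Suc n)" using H K by simp
  note as = assoc_mult_mat[of _ "Suc n" "Suc n" _ "Suc n" _ "Suc n"]
  have HKT: "(H * K)\<^sup>T = K\<^sup>T * H" using H K by (simp add: transpose_mult[of _ "Suc n" "Suc n"])
  have 1: "(H * K)\<^sup>T * (H * K) = 1\<^sub>m (Suc n)"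
  proof -
    have "(H * K)\<^sup>T * (H * K) = K\<^sup>T * ((H * H) * K)" unfolding HKT using H(1) K by (simp add: as)
    then show ?thesis using H K KK by simp
  qed
  have "M = (H * H) * M * (H * H)" using H(3) M by simp
  also have "\<dots> = H * B * H" unfolding B_def using H(1) M by (simp add: as)
  also have "\<dots> = (H * K) * mat_diag (Suc n) e * (H * K)\<^sup>T"
  proof -
    have DK: "mat_diag (Suc n) e * K\<^sup>T \<in> carrier_mat (Suc n) (Suc n)"
      using K by (intro mult_carrier_mat[of _ _ "Suc n"]) auto
    then have "K * (mat_diag (Suc n) e * K\<^sup>T) \<in> carrier_mat (Suc n) (Suc n)"
      using K by (intro mult_carrier_mat[of _ _ "Suc n"]) auto
    then show ?thesis unfolding HKT BK using H(1) K DK by (simp add: as)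
  qed
  finally have 2: "M = (H * K) * mat_diag (Suc n) e * (H * K)\<^sup>T" .
  show ?case by (rule Suc.prems(1)[OF HK 1 2])
qed

section \<open>Characteristic polynomial and quadratic form in eigencoordinates\<close>

lemma char_poly_orthogonal_diag:
  fixes Q :: "real mat"
  assumes Q: "Q \<in> carrier_mat n n" "Q\<^sup>T * Q = 1\<^sub>m n" and M: "M = Q * mat_diag n d * Q\<^sup>T"
  shows "char_poly M = (\<Prod>i<n. [:- d i, 1:])"
proof -
  have "Q * Q\<^sup>T = 1\<^sub>m n" using Q mat_mult_left_right_inverse[of "Q\<^sup>T" n Q] by simp
  then have "similar_mat M (mat_diag n d)"
    using Q M by (intro similar_matI[of _ _ Q "Q\<^sup>T" n]) auto
  then have "char_poly M = char_poly (mat_diag n d)" by (rule char_poly_similar)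
  also have "\<dots> = (\<Prod>a\<leftarrow>diag_mat (mat_diag n d). [:- a, 1:])"
    by (rule char_poly_upper_triangular) (auto simp: mat_diag_def)
  also have "diag_mat (mat_diag n d) = map d [0..<n]"
    by (auto simp: diag_mat_def mat_diag_def)
  also have "(\<Prod>a\<leftarrow>map d [0..<n]. [:- a, 1:]) = (\<Prod>i<n. [:- d i, 1:])"
    by (simp add: o_def prod.list_conv_set_nth interv_sum_list_conv_sum_set_nat flip: prod.distinct_set_conv_list)
       (metis atLeast0LessThan atLeast_upt prod.distinct_set_conv_list distinct_upt)
  finally show ?thesis .
qed

lemma quadratic_form_orthogonal_diag:
  fixes Q :: "real mat"
  assumes Q: "Q \<in> carrier_mat n n" and M: "M = Q * mat_diag n d * Q\<^sup>T" and v: "v \<in> carrier_vec n"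
  shows "v \<bullet> (M *\<^sub>v v) = (\<Sum>i<n. d i * ((Q\<^sup>T *\<^sub>v v) $ i)\<^sup>2)"
proof -
  have w: "Q\<^sup>T *\<^sub>v v \<in> carrier_vec n" using Q v by simp
  have "M *\<^sub>v v = Q *\<^sub>v (mat_diag n d *\<^sub>v (Q\<^sup>T *\<^sub>v v))"
    unfolding M using Q v w by (simp add: assoc_mult_mat_vec[of _ n n _ n])
  then have "v \<bullet> (M *\<^sub>v v) = (Q\<^sup>T *\<^sub>v v) \<bullet> (mat_diag n d *\<^sub>v (Q\<^sup>T *\<^sub>v v))"
    using scalar_prod_mult_mat_vec_transpose[OF Q v, of "mat_diag n d *\<^sub>v (Q\<^sup>T *\<^sub>v v)"] w
    by (simp add: mult_mat_vec_carrier[OF mat_diag_dim])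
  also have "\<dots> = (\<Sum>i<n. d i * ((Q\<^sup>T *\<^sub>v v) $ i)\<^sup>2)"
    using mult_mat_diag_vec_index[OF w, of _ d] carrier_matD[OF mat_diag_dim[of n d]]
    by (simp add: scalar_prod_def[of _ "mat_diag n d *\<^sub>v (Q\<^sup>T *\<^sub>v v)"] atLeast0LessThan
        power2_eq_square ac_simps del: index_mult_mat_vec)
  finally show ?thesis .
qed

lemma scalar_prod_orthogonal:
  fixes Q :: "real mat"
  assumes Q: "Q \<in> carrier_mat n n" "Q\<^sup>T * Q = 1\<^sub>m n" and v: "v \<in> carrier_vec n"
  shows "v \<bullet> v = (\<Sum>i<n. ((Q\<^sup>T *\<^sub>v v) $ i)\<^sup>2)"
proof -
  have "Q * Q\<^sup>T = 1\<^sub>m n" using Q mat_mult_left_right_inverse[of "Q\<^sup>T" n Q] by simp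
  then have "1\<^sub>m n = Q * mat_diag n (\<lambda>_. 1) * Q\<^sup>T" using Q by simp
  from quadratic_form_orthogonal_diag[OF Q(1) this v] show ?thesis using v by simp
qed

lemma sum_mult_unit_vec_sq:
  assumes "i < n" shows "(\<Sum>j<n. f j * (unit_vec n i $ j)\<^sup>2) = (f i :: real)"
proof -
  have "(\<Sum>j<n. f j * (unit_vec n i $ j)\<^sup>2) = (\<Sum>j<n. if j = i then f j else 0)"
    using assms by (intro sum.cong) auto
  then show ?thesis using assms by simp
qed

lemma poly_linear_factors_eq_0_iff:
  "poly (\<Prod>i<n. [:- d i, 1:]) x = 0 \<longleftrightarrow> (\<exists>i<n. x = d i)" for x :: real and n :: nat
  by (auto simp: poly_prod)

text \<open>In eigencoordinates both sides say that every \<open>d i\<close> exceeds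
  \<open>b\<close>; the backward direction tests the form on the columns of \<open>Q\<close>. Root
  bounds are thus converted into form bounds, which restrict to coordinate subspaces, and
  back.\<close>

lemma char_poly_roots_gt_iff_quadratic_form:
  fixes M :: "real mat"
  assumes M: "M \<in> carrier_mat n n" "M\<^sup>T = M"
  shows "(\<forall>x. poly (char_poly M) x = 0 \<longrightarrow> b < x) \<longleftrightarrow>
    (\<forall>v\<in>carrier_vec n. v \<noteq> 0\<^sub>v n \<longrightarrow> b * (v \<bullet> v) < v \<bullet> (M *\<^sub>v v))"
proof -
  obtain Q d where Q: "Q \<in> carrier_mat n n" "Q\<^sup>T * Q = 1\<^sub>m n" and MQ: "M = Q * mat_diag n d * Q\<^sup>T"
    using real_spectral_theorem[OF M] .
  have roots: "(\<forall>x. poly (char_poly M) x = 0 \<longrightarrow> b < x) \<longleftrightarrow> (\<forall>i<n. b < d i)"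
    unfolding char_poly_orthogonal_diag[OF Q MQ] poly_linear_factors_eq_0_iff by auto
  show ?thesis unfolding roots
  proof safe
    fix v :: "real vec" assume d: "\<forall>i<n. b < d i" and v: "v \<in> carrier_vec n" "v \<noteq> 0\<^sub>v n"
    have pos: "0 < (\<Sum>i<n. ((Q\<^sup>T *\<^sub>v v) $ i)\<^sup>2)"
      using scalar_prod_self_pos[OF v] scalar_prod_orthogonal[OF Q v(1)] by simp
    then obtain i where i: "i < n" "(Q\<^sup>T *\<^sub>v v) $ i \<noteq> 0"
      by (metis (no_types, lifting) lessThan_iff less_irrefl sum.neutral zero_power2)
    have "b * (v \<bullet> v) = (\<Sum>i<n. b * ((Q\<^sup>T *\<^sub>v v) $ i)\<^sup>2)"
      unfolding scalar_prod_orthogonal[OF Q v(1)] by (simp add: sum_distrib_left)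
    also have "\<dots> < (\<Sum>i<n. d i * ((Q\<^sup>T *\<^sub>v v) $ i)\<^sup>2)"
      using d i by (intro sum_strict_mono_ex1) (auto intro!: mult_right_mono bexI[of _ i] mult_strict_right_mono simp del: index_mult_mat_vec)
    finally show "b * (v \<bullet> v) < v \<bullet> (M *\<^sub>v v)"
      using quadratic_form_orthogonal_diag[OF Q(1) MQ v(1)] by simp
  next
    fix i assume *: "\<forall>v\<in>carrier_vec n. v \<noteq> 0\<^sub>v n \<longrightarrow> b * (v \<bullet> v) < v \<bullet> (M *\<^sub>v v)" and i: "i < n"
    define v where "v = Q *\<^sub>v unit_vec n i"
    have v: "v \<in> carrier_vec n" unfolding v_def using Q by simp
    have "Q\<^sup>T *\<^sub>v v = (Q\<^sup>T * Q) *\<^sub>v unit_vec n i"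
      unfolding v_def using Q(1) by (simp add: assoc_mult_mat_vec[of _ n n _ n])
    then have Qv: "Q\<^sup>T *\<^sub>v v = unit_vec n i" using Q by simp
    have vv: "v \<bullet> v = 1"
      unfolding scalar_prod_orthogonal[OF Q v] Qv using i
      by (simp add: sum_mult_unit_vec_sq[of i n "\<lambda>_. 1", simplified])
    then have "v \<noteq> 0\<^sub>v n" by auto
    then have "b * (v \<bullet> v) < v \<bullet> (M *\<^sub>v v)" using * v by blast
    also have "v \<bullet> (M *\<^sub>v v) = d i"
      unfolding quadratic_form_orthogonal_diag[OF Q(1) MQ v] Qv
      by (rule sum_mult_unit_vec_sq[OF i])
    finally show "b < d i" using vv by simp
  qed
qed

section \<open>Deleting rows and columns\<close>

lemma pderiv_mult_linear_factor:
  "pderiv (p * [:- c, 1:]) = p + [:- c, 1:] * pderiv p" for c :: "'a::idom"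
  by (subst pderiv_mult) (simp add: pderiv_pCons)

lemma poly_pderiv_linear_factors:
  fixes d :: "nat \<Rightarrow> real"
  assumes "\<And>i. i < n \<Longrightarrow> x \<noteq> d i"
  shows "poly (pderiv (\<Prod>i<n. [:- d i, 1:])) x = poly (\<Prod>i<n. [:- d i, 1:]) x * (\<Sum>i<n. 1 / (x - d i))"
  using assms
proof (induction n)
  case (Suc n)
  have x: "x \<noteq> d i" if "i < n" for i using Suc.prems[of i] that by simp
  define r where "r = x - d n"
  have "r \<noteq> 0" using Suc.prems[of n] by (simp add: r_def)
  moreover have "poly (pderiv (\<Prod>i<Suc n. [:- d i, 1:])) x =
      poly (pderiv (\<Prod>i<n. [:- d i, 1:])) x * r + poly (\<Prod>i<n. [:- d i, 1:]) x"
    unfolding prod.lessThan_Suc pderiv_mult_linear_factor by (simp add: r_def algebra_simps)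
  moreover have "poly (\<Prod>i<Suc n. [:- d i, 1:]) x = poly (\<Prod>i<n. [:- d i, 1:]) x * r"
    by (simp add: r_def algebra_simps)
  ultimately show ?case
    using Suc.IH[OF x] by (simp add: r_def[symmetric] distrib_left)
qed simp

text \<open>With \<open>S\<close> the sum of the reciprocals, \<open>P' = P * S\<close> and
  \<open>S'\<close> is minus the sum of their squares, so
  \<open>P'' = P * S\<^sup>2 + P * S'\<close>. The induction over the factors needs only the product
  rule for polynomials.\<close>

lemma poly_pderiv_pderiv_linear_factors:
  fixes d :: "nat \<Rightarrow> real"
  assumes "\<And>i. i < n \<Longrightarrow> x \<noteq> d i"
  shows "poly (pderiv (pderiv (\<Prod>i<n. [:- d i, 1:]))) x =
    poly (\<Prod>i<n. [:- d i, 1:]) x * ((\<Sum>i<n. 1 / (x - d i))\<^sup>2 - (\<Sum>i<n. (1 / (x - d i))\<^sup>2))"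
  using assms
proof (induction n)
  case (Suc n)
  have x: "x \<noteq> d i" if "i < n" for i using Suc.prems[of i] that by simp
  define P S T r where "P = poly (\<Prod>i<n. [:- d i, 1:]) x" and "S = (\<Sum>i<n. 1 / (x - d i))"
    and "T = (\<Sum>i<n. (1 / (x - d i))\<^sup>2)" and "r = x - d n"
  have r: "r \<noteq> 0" using Suc.prems[of n] by (simp add: r_def)
  have "poly (pderiv (pderiv (\<Prod>i<Suc n. [:- d i, 1:]))) x = P * (S\<^sup>2 - T) * r + 2 * (P * S)"
  proof -
    have "poly (pderiv (pderiv (\<Prod>i<Suc n. [:- d i, 1:]))) x =
        poly (pderiv (pderiv (\<Prod>i<n. [:- d i, 1:]))) x * r + 2 * poly (pderiv (\<Prod>i<n. [:- d i, 1:])) x"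
      unfolding prod.lessThan_Suc pderiv_mult_linear_factor pderiv_add
        mult.commute[of "[:- d n, 1:]"] by (simp add: r_def algebra_simps)
    then show ?thesis
      using Suc.IH[OF x] poly_pderiv_linear_factors[of n x d, OF x] by (simp add: P_def S_def T_def)
  qed
  also have "\<dots> = P * r * ((S + 1 / r)\<^sup>2 - (T + (1 / r)\<^sup>2))"
    using r by (simp add: power2_eq_square field_simps)
  moreover have "poly (\<Prod>i<Suc n. [:- d i, 1:]) x = P * r" by (simp add: P_def r_def algebra_simps)
  ultimately show ?case by (simp add: S_def T_def r_def)
qed simp

text \<open>With \<open>z\<^sub>i = 1 / (\<lambda>\<^sub>i - b - 1 / U)\<close> this bounds the barrier function of \<open>P'\<close> at \<open>b + 1 / U\<close>
  by that of \<open>P\<close> at \<open>b\<close>, for a polynomial \<open>P\<close> with the roots \<open>\<lambda>\<^sub>i\<close>.\<close>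

lemma sum_square_minus_sum_squares_le:
  fixes z :: "'a \<Rightarrow> real"
  assumes z: "\<And>i. i \<in> I \<Longrightarrow> 0 < z i" and U: "0 < U"
    and le: "(\<Sum>i\<in>I. z i / (z i + U)) \<le> 1"
  shows "(\<Sum>i\<in>I. z i)\<^sup>2 - (\<Sum>i\<in>I. (z i)\<^sup>2) \<le> U * (\<Sum>i\<in>I. z i)"
proof -
  \<comment> \<open>The substitution \<open>z i = U * (a i * g i)\<close> with
    \<open>(1 - a i) * g i = 1\<close> turns the hypothesis into the statement that the weights
    \<open>a i\<close> sum to at most \<open>1\<close>. The claim becomes \<open>(\<Sum>i\<in>I. a i
    * g i)\<^sup>2 \<le> (\<Sum>i\<in>I. a i * (g i)\<^sup>2)\<close>, which is Cauchy-Schwarz for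
    such weights.\<close>
  define a g where "a = (\<lambda>i. z i / (z i + U))" and "g = (\<lambda>i. (z i + U) / U)"
  have zU: "z i + U > 0" if "i \<in> I" for i using z[OF that] U by simp
  have a0: "0 \<le> a i" if "i \<in> I" for i unfolding a_def using z[OF that] U by simp
  have z_eq: "z i = U * (a i * g i)" if "i \<in> I" for i
    unfolding a_def g_def using zU[OF that] U by simp
  have ag: "a i * g i = a i * (g i)\<^sup>2 - (a i)\<^sup>2 * (g i)\<^sup>2" if "i \<in> I" for i
  proof -
    have "1 - a i = U / (z i + U)" unfolding a_def using zU[OF that] by (simp add: diff_divide_eq_iff)
    then have "(1 - a i) * g i = 1" unfolding g_def using zU[OF that] U by simp
    moreover have "a i * (g i)\<^sup>2 - (a i)\<^sup>2 * (g i)\<^sup>2 = a i * g i * ((1 - a i) * g i)"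
      by (simp add: power2_eq_square algebra_simps)
    ultimately show ?thesis by simp
  qed
  have "(\<Sum>i\<in>I. a i * g i)\<^sup>2 = (\<Sum>i\<in>I. \<Sum>j\<in>I. (a i * a j) * (g i * g j))"
    by (simp add: power2_eq_square sum_product ac_simps)
  also have "\<dots> \<le> (\<Sum>i\<in>I. \<Sum>j\<in>I. (a i * a j) * (((g i)\<^sup>2 + (g j)\<^sup>2) / 2))"
  proof (intro sum_mono mult_left_mono)
    fix i j show "g i * g j \<le> ((g i)\<^sup>2 + (g j)\<^sup>2) / 2"
      using sum_squares_bound[of "g i" "g j"] by simp
  qed (use a0 in auto)
  also have "\<dots> = (\<Sum>i\<in>I. \<Sum>j\<in>I. a i * (g i)\<^sup>2 / 2 * a j) + (\<Sum>i\<in>I. \<Sum>j\<in>I. a i * (a j * (g j)\<^sup>2 / 2))"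
    by (simp add: sum.distrib[symmetric] algebra_simps add_divide_distrib)
  also have "\<dots> = (\<Sum>i\<in>I. a i * (g i)\<^sup>2) * (\<Sum>i\<in>I. a i)"
    by (simp add: sum_product[symmetric] sum_divide_distrib[symmetric])
  also have "\<dots> \<le> (\<Sum>i\<in>I. a i * (g i)\<^sup>2) * 1"
    using le a0 unfolding a_def[symmetric] by (intro mult_left_mono sum_nonneg) auto
  finally have sq: "(\<Sum>i\<in>I. a i * g i)\<^sup>2 \<le> (\<Sum>i\<in>I. a i * (g i)\<^sup>2) * 1" .
  then have *: "(\<Sum>i\<in>I. a i * g i)\<^sup>2 - (\<Sum>i\<in>I. (a i)\<^sup>2 * (g i)\<^sup>2) \<le> (\<Sum>i\<in>I. a i * g i)"
  proof -
    have "(\<Sum>i\<in>I. a i * g i) = (\<Sum>i\<in>I. a i * (g i)\<^sup>2) - (\<Sum>i\<in>I. (a i)\<^sup>2 * (g i)\<^sup>2)"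
      unfolding sum_subtractf[symmetric] by (intro sum.cong refl ag)
    then show ?thesis using sq by linarith
  qed
  have "(\<Sum>i\<in>I. z i)\<^sup>2 - (\<Sum>i\<in>I. (z i)\<^sup>2) =
      U\<^sup>2 * ((\<Sum>i\<in>I. a i * g i)\<^sup>2 - (\<Sum>i\<in>I. (a i)\<^sup>2 * (g i)\<^sup>2))"
    using z_eq by (simp add: sum_distrib_left[symmetric] power_mult_distrib right_diff_distrib)
  also have "\<dots> \<le> U\<^sup>2 * (\<Sum>i\<in>I. a i * g i)" using * by (intro mult_left_mono) auto
  also have "\<dots> = U * (\<Sum>i\<in>I. z i)"
    using z_eq by (simp add: sum_distrib_left[symmetric] power2_eq_square)
  finally show ?thesis .
qed

text \<open>Rows and columns are listed by an index map rather than a set, so that successive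
  deletions compose as maps and the image of \<open>{..<t}\<close> under \<open>f\<close> records
  the surviving coordinates.\<close>

definition principal_submatrix :: "'a mat \<Rightarrow> nat \<Rightarrow> (nat \<Rightarrow> nat) \<Rightarrow> 'a mat" where
  "principal_submatrix M t f = mat t t (\<lambda>(i,j). M $$ (f i, f j))"

lemma principal_submatrix_carrier [simp]: "principal_submatrix M t f \<in> carrier_mat t t"
  by (simp add: principal_submatrix_def)

lemma principal_submatrix_id: "M \<in> carrier_mat m m \<Longrightarrow> principal_submatrix M m (\<lambda>i. i) = M"
  by (intro eq_matI) (auto simp: principal_submatrix_def)

lemma transpose_principal_submatrix:
  assumes "M \<in> carrier_mat m m" "M\<^sup>T = M" "f ` {..<t} \<subseteq> {..<m}"
  shows "(principal_submatrix M t f)\<^sup>T = principal_submatrix M t f"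
proof (rule eq_matI)
  fix i j assume "i < dim_row (principal_submatrix M t f)" "j < dim_col (principal_submatrix M t f)"
  then have "i < t" "j < t" by (auto simp: principal_submatrix_def)
  then show "(principal_submatrix M t f)\<^sup>T $$ (i,j) = principal_submatrix M t f $$ (i,j)"
    using assms(1,3) arg_cong[OF assms(2), of "\<lambda>M. M $$ (f i, f j)"]
    by (auto simp: principal_submatrix_def image_subset_iff)
qed (auto simp: principal_submatrix_def)

lemma mat_delete_principal_submatrix:
  assumes "j < Suc t"
  shows "mat_delete (principal_submatrix M (Suc t) f) j j = principal_submatrix M t (f \<circ> insert_index j)"
  using assms by (intro eq_matI) (auto simp: mat_delete_def principal_submatrix_def insert_index_def)

text \<open>Vectors supported on the chosen coordinates see only the corresponding entries of
  \<open>M\<close>. For a Gram matrix this expresses the squared length of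
  \<open>restrict_op A \<sigma> a\<close> through the small matrix.\<close>

lemma quadratic_form_coord_incl:
  assumes M: "M \<in> carrier_mat m m" and f: "inj_on f {..<t}" "f ` {..<t} \<subseteq> {..<m}"
  shows "coord_incl m (f ` {..<t}) a \<bullet> (M *\<^sub>v coord_incl m (f ` {..<t}) a) =
    vec t (a \<circ> f) \<bullet> (principal_submatrix M t f *\<^sub>v vec t (a \<circ> f))"
proof -
  define w where "w = coord_incl m (f ` {..<t}) a"
  have red: "(\<Sum>k<m. w $ k * h k) = (\<Sum>i<t. a (f i) * h (f i))" for h
  proof -
    have "(\<Sum>k<m. w $ k * h k) = (\<Sum>k\<in>f ` {..<t}. a k * h k)"
      using f(2) by (intro sum.mono_neutral_cong_right) (auto simp: w_def coord_incl_def)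
    also have "\<dots> = (\<Sum>i<t. a (f i) * h (f i))" by (subst sum.reindex[OF f(1)]) simp
    finally show ?thesis .
  qed
  have w: "w \<in> carrier_vec m" by (simp add: w_def coord_incl_def)
  have "w \<bullet> (M *\<^sub>v w) = (\<Sum>k<m. w $ k * (\<Sum>l<m. w $ l * M $$ (k,l)))"
    using w M by (simp add: scalar_prod_def atLeast0LessThan ac_simps)
  also have "\<dots> = (\<Sum>i<t. a (f i) * (\<Sum>j<t. a (f j) * M $$ (f i, f j)))" by (simp add: red)
  also have "\<dots> = vec t (a \<circ> f) \<bullet> (principal_submatrix M t f *\<^sub>v vec t (a \<circ> f))"
    by (simp add: scalar_prod_def atLeast0LessThan principal_submatrix_def ac_simps)
  finally show ?thesis unfolding w_def .
qed

lemma scalar_prod_coord_incl: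
  assumes f: "inj_on f {..<t}" "f ` {..<t} \<subseteq> {..<m}"
  shows "coord_incl m (f ` {..<t}) a \<bullet> coord_incl m (f ` {..<t}) a = vec t (a \<circ> f) \<bullet> vec t (a \<circ> f)"
proof -
  have "vec t (a \<circ> f) \<bullet> (principal_submatrix (1\<^sub>m m :: real mat) t f *\<^sub>v vec t (a \<circ> f)) = vec t (a \<circ> f) \<bullet> vec t (a \<circ> f)"
  proof -
    have "principal_submatrix (1\<^sub>m m :: real mat) t f = 1\<^sub>m t"
      using f by (intro eq_matI) (auto simp: principal_submatrix_def inj_on_def image_subset_iff)
    then show ?thesis by simp
  qed
  then show ?thesis
    using quadratic_form_coord_incl[OF one_carrier_mat f, of a] by (simp add: coord_incl_def)
qed

text \<open>Passing to a principal submatrix restricts the quadratic form to a coordinate subspace,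
  so a lower bound for the spectrum survives. This is the half of Cauchy interlacing that concerns
  the smallest eigenvalue.\<close>

lemma roots_gt_principal_submatrix:
  fixes M :: "real mat"
  assumes M: "M \<in> carrier_mat m m" "M\<^sup>T = M" and f: "inj_on f {..<t}" "f ` {..<t} \<subseteq> {..<m}"
    and roots: "\<And>x. poly (char_poly M) x = 0 \<Longrightarrow> b < x"
    and x: "poly (char_poly (principal_submatrix M t f)) x = 0"
  shows "b < x"
proof -
  have qf: "b * (v \<bullet> v) < v \<bullet> (M *\<^sub>v v)" if "v \<in> carrier_vec m" "v \<noteq> 0\<^sub>v m" for v
    using char_poly_roots_gt_iff_quadratic_form[OF M, of b] roots that by blast
  have "b * (v \<bullet> v) < v \<bullet> (principal_submatrix M t f *\<^sub>v v)"
    if v: "v \<in> carrier_vec t" "v \<noteq> 0\<^sub>v t" for v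
  proof -
    define a where "a = (\<lambda>k. v $ (inv_into {..<t} f k))"
    define w where "w = coord_incl m (f ` {..<t}) a"
    have v_eq: "v = vec t (a \<circ> f)"
      using v(1) f(1) by (intro eq_vecI) (auto simp: a_def)
    have w: "w \<in> carrier_vec m" by (simp add: w_def coord_incl_def)
    have ww: "w \<bullet> w = v \<bullet> v" unfolding w_def v_eq by (rule scalar_prod_coord_incl[OF f])
    then have "w \<noteq> 0\<^sub>v m" using scalar_prod_self_pos[OF v] by auto
    from qf[OF w this] show ?thesis
      unfolding ww unfolding w_def quadratic_form_coord_incl[OF M(1) f] v_eq[symmetric] .
  qed
  then show ?thesis
    using char_poly_roots_gt_iff_quadratic_form[OF principal_submatrix_carrier
        transpose_principal_submatrix[OF M f(2)], of b] x by blast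
qed

lemma char_poly_real_symmetric_splits:
  fixes M :: "real mat"
  assumes "M \<in> carrier_mat n n" "M\<^sup>T = M"
  obtains d where "char_poly M = (\<Prod>i<n. [:- d i, 1:])"
  using real_spectral_theorem[OF assms] char_poly_orthogonal_diag by metis

text \<open>Each of the \<open>n\<close> factors \<open>b - d i\<close> is negative. Knowing the
  sign allows the denominators in the barrier ratios to be cleared before summing.\<close>

lemma poly_char_poly_below_roots:
  fixes M :: "real mat"
  assumes M: "M \<in> carrier_mat n n" "M\<^sup>T = M" and roots: "\<And>x. poly (char_poly M) x = 0 \<Longrightarrow> b < x"
  shows "0 < (-1) ^ n * poly (char_poly M) b"
proof -
  obtain d where d: "char_poly M = (\<Prod>i<n. [:- d i, 1:])"
    using char_poly_real_symmetric_splits[OF M] .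
  have "(-1) ^ n * poly (char_poly M) b = (\<Prod>i<n. d i - b)"
  proof -
    have "(\<Prod>i<n. d i - b) = (\<Prod>i<n. (-1) * (b - d i))" by simp
    also have "\<dots> = (-1) ^ n * poly (char_poly M) b"
      unfolding d prod.distrib by (simp add: poly_prod)
    finally show ?thesis by simp
  qed
  moreover have "d i > b" if "i < n" for i
    using roots[of "d i"] that unfolding d poly_linear_factors_eq_0_iff by blast
  ultimately show ?thesis by (auto intro!: prod_pos)
qed

text \<open>The barrier function \<open>\<Sum>i. 1 / (\<lambda>\<^sub>i - b)\<close> of the eigenvalues is \<open>- P'(b) / P(b)\<close> for the
  characteristic polynomial \<open>P\<close>. The polynomials \<open>P\<^sub>j\<close> of the maximal principal submatrices add up
  to \<open>P'\<close>, so the barrier function of one of them is at most that of \<open>P'\<close>.\<close>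

lemma barrier_mat_delete:
  fixes M :: "real mat"
  assumes M: "M \<in> carrier_mat (Suc t) (Suc t)" "M\<^sup>T = M" and t: "0 < t" and U: "0 < U"
    and roots: "\<And>x. poly (char_poly M) x = 0 \<Longrightarrow> b < x"
    and barrier: "- poly (pderiv (char_poly M)) b / poly (char_poly M) b \<le> U"
  shows "\<exists>j<Suc t. (\<forall>x. poly (char_poly (mat_delete M j j)) x = 0 \<longrightarrow> b + 1 / U < x) \<and>
    - poly (pderiv (char_poly (mat_delete M j j))) (b + 1 / U) /
      poly (char_poly (mat_delete M j j)) (b + 1 / U) \<le> U"
proof -
  define c where "c = b + 1 / U"
  obtain d where d: "char_poly M = (\<Prod>i<Suc t. [:- d i, 1:])"
    using char_poly_real_symmetric_splits[OF M] .
  have db: "d i > b" if "i < Suc t" for i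
    using roots[of "d i"] that unfolding d poly_linear_factors_eq_0_iff by blast
  have Pb: "poly (char_poly M) b \<noteq> 0" using roots by blast
  have "- poly (pderiv (char_poly M)) b / poly (char_poly M) b = (\<Sum>i<Suc t. 1 / (d i - b))"
  proof -
    have "poly (pderiv (char_poly M)) b = poly (char_poly M) b * (\<Sum>i<Suc t. 1 / (b - d i))"
      unfolding d using db by (intro poly_pderiv_linear_factors) force
    moreover have "- (\<Sum>i<Suc t. 1 / (b - d i)) = (\<Sum>i<Suc t. 1 / (d i - b))"
      unfolding sum_negf[symmetric] by (intro sum.cong) (auto simp: minus_divide_right)
    ultimately show ?thesis using Pb by (simp del: sum.lessThan_Suc)
  qed
  then have sumU: "(\<Sum>i<Suc t. 1 / (d i - b)) \<le> U" using barrier by simp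
  \<comment> \<open>Strictness comes from a second eigenvalue, available because
    \<open>0 < t\<close>: its positive reciprocal keeps \<open>1 / (d i - b)\<close> strictly below
    \<open>U\<close>, so raising the barrier by \<open>1 / U\<close> does not reach
    \<open>d i\<close>.\<close>
  have dc: "d i > c" if i: "i < Suc t" for i
  proof -
    define i' where "i' = (if i = 0 then 1 else 0 :: nat)"
    have i': "i' < Suc t" "i' \<noteq> i" using t by (auto simp: i'_def)
    have "1 / (d i - b) < 1 / (d i - b) + 1 / (d i' - b)" using db[OF i'(1)] by simp
    also have "\<dots> = (\<Sum>i\<in>{i,i'}. 1 / (d i - b))" using i' by simp
    also have "\<dots> \<le> (\<Sum>i<Suc t. 1 / (d i - b))"
      using i i' db by (intro sum_mono2) (auto simp: less_imp_le)
    finally have "1 / (d i - b) < U" using sumU by linarith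
    then show ?thesis using db[OF i] U unfolding c_def by (simp add: field_simps)
  qed
  have rootsM: "c < x" if "poly (char_poly M) x = 0" for x
    using dc that unfolding d poly_linear_factors_eq_0_iff by blast
  have princ: "mat_delete M j j = principal_submatrix M t (insert_index j)" if "j < Suc t" for j
    using mat_delete_principal_submatrix[OF that, of M "\<lambda>i. i"]
    unfolding principal_submatrix_id[OF M(1)] by (simp add: comp_def)
  have ins: "insert_index j ` {..<t} \<subseteq> {..<Suc t}" for j by (auto simp: insert_index_def)
  have del: "mat_delete M j j \<in> carrier_mat t t" "(mat_delete M j j)\<^sup>T = mat_delete M j j"
      "\<And>x. poly (char_poly (mat_delete M j j)) x = 0 \<Longrightarrow> c < x" if "j < Suc t" for j
    unfolding princ[OF that]
    using transpose_principal_submatrix[OF M ins] rootsM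
      roots_gt_principal_submatrix[OF M insert_index_inj_on ins] by auto
  \<comment> \<open>The submatrices have size \<open>t\<close>, so \<open>e\<close> is the sign of
    their polynomials at \<open>c\<close>; the polynomial of \<open>M\<close> has the opposite sign
    there, whence the minus sign in \<open>eP\<close>.\<close>
  define e where "e = (-1::real) ^ t"
  define z where "z = (\<lambda>i. 1 / (d i - c))"
  have eP: "0 < - e * poly (char_poly M) c"
    using poly_char_poly_below_roots[OF M rootsM] by (simp add: e_def)
  have dP: "poly (pderiv (char_poly M)) c = poly (char_poly M) c * - (\<Sum>i<Suc t. z i)"
  proof -
    have "poly (pderiv (char_poly M)) c = poly (char_poly M) c * (\<Sum>i<Suc t. 1 / (c - d i))"
      unfolding d using dc by (intro poly_pderiv_linear_factors) force
    also have "(\<Sum>i<Suc t. 1 / (c - d i)) = - (\<Sum>i<Suc t. z i)"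
      unfolding sum_negf[symmetric] z_def by (intro sum.cong) (auto simp: minus_divide_right)
    finally show ?thesis .
  qed
  have ddP: "poly (pderiv (pderiv (char_poly M))) c =
      poly (char_poly M) c * ((\<Sum>i<Suc t. z i)\<^sup>2 - (\<Sum>i<Suc t. (z i)\<^sup>2))"
  proof -
    have "poly (pderiv (pderiv (char_poly M))) c =
        poly (char_poly M) c * ((\<Sum>i<Suc t. 1 / (c - d i))\<^sup>2 - (\<Sum>i<Suc t. (1 / (c - d i))\<^sup>2))"
      unfolding d using dc by (intro poly_pderiv_pderiv_linear_factors) force
    also have "(\<Sum>i<Suc t. 1 / (c - d i)) = - (\<Sum>i<Suc t. z i)"
      unfolding sum_negf[symmetric] z_def by (intro sum.cong) (auto simp: minus_divide_right)
    also have "(\<Sum>i<Suc t. (1 / (c - d i))\<^sup>2) = (\<Sum>i<Suc t. (z i)\<^sup>2)"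
      unfolding z_def by (intro sum.cong) (auto simp: power_divide power2_commute)
    finally show ?thesis by (simp del: sum.lessThan_Suc)
  qed
  \<comment> \<open>Since \<open>1 / z i + 1 / U = d i - b\<close>, each quotient is
    \<open>1 / U\<close> times a term of the old barrier sum, and together they give at most
    \<open>1\<close>.\<close>
  have "(\<Sum>i<Suc t. z i / (z i + U)) = (\<Sum>i<Suc t. 1 / U * (1 / (d i - b)))"
  proof (intro sum.cong refl)
    fix i assume "i \<in> {..<Suc t}"
    then have "d i - c > 0" "d i - b > 0" "d i - b = d i - c + 1 / U" using dc db by (auto simp: c_def)
    then show "z i / (z i + U) = 1 / U * (1 / (d i - b))"
      using U unfolding z_def by (simp add: field_simps)
  qed
  also have "\<dots> = 1 / U * (\<Sum>i<Suc t. 1 / (d i - b))" by (simp only: sum_distrib_left)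
  also have "\<dots> \<le> 1 / U * U" using sumU U by (intro mult_left_mono) auto
  also have "\<dots> = 1" using U by simp
  finally have key: "(\<Sum>i<Suc t. z i)\<^sup>2 - (\<Sum>i<Suc t. (z i)\<^sup>2) \<le> U * (\<Sum>i<Suc t. z i)"
    using dc U by (intro sum_square_minus_sum_squares_le) (auto simp: z_def)
  \<comment> \<open>If every deletion violated the bound, multiplying by the positive numbers
    \<open>e * poly (char_poly (mat_delete M j j)) c\<close> and summing over \<open>j\<close> would
    make the derivative of \<open>char_poly M\<close> violate it too, contradicting
    \<open>key\<close>.\<close>
  have "\<exists>j<Suc t. - poly (pderiv (char_poly (mat_delete M j j))) c / poly (char_poly (mat_delete M j j)) c \<le> U"
  proof (rule ccontr)
    assume "\<not> ?thesis"
    then have gt: "U < - poly (pderiv (char_poly (mat_delete M j j))) c / poly (char_poly (mat_delete M j j)) c"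
      if "j < Suc t" for j using that not_le by blast
    have lt: "U * (e * poly (char_poly (mat_delete M j j)) c) < - e * poly (pderiv (char_poly (mat_delete M j j))) c"
      if "j < Suc t" for j
    proof -
      have pos: "0 < e * poly (char_poly (mat_delete M j j)) c"
        using poly_char_poly_below_roots[OF del[OF that]] by (simp add: e_def)
      then have "- poly (pderiv (char_poly (mat_delete M j j))) c / poly (char_poly (mat_delete M j j)) c *
          (e * poly (char_poly (mat_delete M j j)) c) = - e * poly (pderiv (char_poly (mat_delete M j j))) c"
        by auto
      then show ?thesis using mult_strict_right_mono[OF gt[OF that] pos] by simp
    qed
    have "(\<Sum>j<Suc t. U * (e * poly (char_poly (mat_delete M j j)) c)) <
        (\<Sum>j<Suc t. - e * poly (pderiv (char_poly (mat_delete M j j))) c)"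
    proof (rule sum_strict_mono)
      show "{..<Suc t} \<noteq> {}" by auto
    qed (use lt in simp_all)
    moreover have "poly (pderiv (char_poly M)) c = (\<Sum>j<Suc t. poly (char_poly (mat_delete M j j)) c)"
      unfolding pderiv_char_poly[OF M(1)] poly_sum ..
    moreover have "poly (pderiv (pderiv (char_poly M))) c =
        (\<Sum>j<Suc t. poly (pderiv (char_poly (mat_delete M j j))) c)"
      unfolding pderiv_char_poly[OF M(1)] pderiv_sum poly_sum ..
    ultimately have "U * (e * poly (pderiv (char_poly M)) c) < - e * poly (pderiv (pderiv (char_poly M))) c"
      by (simp only: sum_distrib_left)
    then have "(- e * poly (char_poly M) c) * (U * (\<Sum>i<Suc t. z i)) <
        (- e * poly (char_poly M) c) * ((\<Sum>i<Suc t. z i)\<^sup>2 - (\<Sum>i<Suc t. (z i)\<^sup>2))"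
      unfolding dP ddP by (simp only: mult_minus_left mult_minus_right mult.assoc mult.left_commute minus_minus)
    then show False using key eP by (meson mult_left_mono not_less less_imp_le)
  qed
  then show ?thesis using del(3) unfolding c_def by blast
qed

text \<open>Each deletion raises the barrier by \<open>1 / U\<close> and keeps the potential below
  the same \<open>U\<close>, so it can be repeated \<open>m - k\<close> times.\<close>

lemma exists_principal_submatrix_roots_gt:
  fixes M :: "real mat"
  assumes M: "M \<in> carrier_mat m m" "M\<^sup>T = M" and U: "0 < U"
    and roots: "\<And>x. poly (char_poly M) x = 0 \<Longrightarrow> b < x"
    and barrier: "- poly (pderiv (char_poly M)) b / poly (char_poly M) b \<le> U"
    and k: "0 < k" "k \<le> m"
  shows "\<exists>f. inj_on f {..<k} \<and> f ` {..<k} \<subseteq> {..<m} \<and>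
    (\<forall>x. poly (char_poly (principal_submatrix M k f)) x = 0 \<longrightarrow> b + real (m - k) / U < x)"
proof -
  \<comment> \<open>The induction carries the potential along with the root bound. As
    \<open>r < m\<close>, every deletion starts from a matrix of size at least two, as
    \<open>barrier_mat_delete\<close> demands.\<close>
  have "\<exists>f. inj_on f {..<m - r} \<and> f ` {..<m - r} \<subseteq> {..<m} \<and>
    (\<forall>x. poly (char_poly (principal_submatrix M (m - r) f)) x = 0 \<longrightarrow> b + real r / U < x) \<and>
    - poly (pderiv (char_poly (principal_submatrix M (m - r) f))) (b + real r / U) /
      poly (char_poly (principal_submatrix M (m - r) f)) (b + real r / U) \<le> U" if "r < m" for r
    using that
  proof (induction r)
    case 0
    show ?case using roots barrier
      by (intro exI[of _ "\<lambda>i. i"]) (auto simp: principal_submatrix_id[OF M(1)])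
  next
    case (Suc r)
    define t where "t = m - Suc r"
    have t: "m - r = Suc t" "0 < t" using Suc.prems by (auto simp: t_def)
    have "r < m" using Suc.prems by simp
    from Suc.IH[OF this] obtain f where f: "inj_on f {..<Suc t}" "f ` {..<Suc t} \<subseteq> {..<m}"
      "\<And>x. poly (char_poly (principal_submatrix M (Suc t) f)) x = 0 \<Longrightarrow> b + real r / U < x"
      "- poly (pderiv (char_poly (principal_submatrix M (Suc t) f))) (b + real r / U) /
      poly (char_poly (principal_submatrix M (Suc t) f)) (b + real r / U) \<le> U"
      unfolding t(1) by blast
    obtain j where j: "j < Suc t"
      "\<And>x. poly (char_poly (mat_delete (principal_submatrix M (Suc t) f) j j)) x = 0 \<Longrightarrow> b + real r / U + 1 / U < x"
      "- poly (pderiv (char_poly (mat_delete (principal_submatrix M (Suc t) f) j j))) (b + real r / U + 1 / U) /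
      poly (char_poly (mat_delete (principal_submatrix M (Suc t) f) j j)) (b + real r / U + 1 / U) \<le> U"
      using barrier_mat_delete[OF principal_submatrix_carrier transpose_principal_submatrix[OF M f(2)] t(2) U f(3,4)]
      by blast
    have ins: "insert_index j ` {..<t} \<subseteq> {..<Suc t}" by (auto simp: insert_index_def)
    have eq: "b + real r / U + 1 / U = b + real (Suc r) / U" by (simp add: add_divide_distrib)
    have "inj_on (f \<circ> insert_index j) {..<t}"
      using inj_on_subset[OF f(1) ins] by (intro comp_inj_on insert_index_inj_on)
    moreover have "(f \<circ> insert_index j) ` {..<t} \<subseteq> {..<m}"
      using f(2) ins by (auto simp: image_subset_iff)
    ultimately show ?case
      using j(2,3) unfolding mat_delete_principal_submatrix[OF j(1)] t_def[symmetric] eq by blast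
  qed
  from this[of "m - k"] k show ?thesis by auto
qed

section \<open>Singular values and inverses of restrictions\<close>

lemma psd_mat_orthogonal_diag:
  fixes Q :: "real mat"
  assumes Q: "Q \<in> carrier_mat n n" and d: "\<And>i. i < n \<Longrightarrow> 0 \<le> d i"
  shows "psd_mat (Q * mat_diag n d * Q\<^sup>T)"
proof -
  let ?M = "Q * mat_diag n d * Q\<^sup>T"
  have c: "?M \<in> carrier_mat n n" using Q by (intro mult_carrier_mat[of _ n n]) auto
  have QD: "Q * mat_diag n d \<in> carrier_mat n n" using Q by (intro mult_carrier_mat[of _ n n]) auto
  have "?M\<^sup>T = (Q\<^sup>T)\<^sup>T * (Q * mat_diag n d)\<^sup>T"
    using Q QD by (intro transpose_mult[of _ n n _ n]) auto
  also have "(Q * mat_diag n d)\<^sup>T = (mat_diag n d)\<^sup>T * Q\<^sup>T"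
    using Q by (intro transpose_mult[of _ n n _ n]) auto
  also have "(mat_diag n d)\<^sup>T = mat_diag n d" by (rule eq_matI) (auto simp: mat_diag_def)
  also have "(Q\<^sup>T)\<^sup>T * (mat_diag n d * Q\<^sup>T) = ?M"
    using Q by (simp add: assoc_mult_mat[of _ n n _ n _ n])
  finally have "?M\<^sup>T = ?M" .
  moreover have "0 \<le> v \<bullet> (?M *\<^sub>v v)" if "v \<in> carrier_vec n" for v
    unfolding quadratic_form_orthogonal_diag[OF Q refl that]
    using d by (intro sum_nonneg mult_nonneg_nonneg) auto
  ultimately show ?thesis unfolding psd_mat_def using c by auto
qed

text \<open>For \<open>r > 0\<close> the vector \<open>y = C v - r v\<close> satisfies
  \<open>C y = - r y\<close>, which semidefiniteness permits only for \<open>y = 0\<close>. For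
  \<open>r = 0\<close> symmetry gives \<open>y \<bullet> y = v \<bullet> C (C v) = 0\<close>
  instead.\<close>

lemma psd_mat_eigenvector_of_square:
  fixes C :: "real mat"
  assumes C: "C \<in> carrier_mat n n" "psd_mat C" and v: "v \<in> carrier_vec n"
    and r: "0 \<le> r" and eig: "C *\<^sub>v (C *\<^sub>v v) = r\<^sup>2 \<cdot>\<^sub>v v"
  shows "C *\<^sub>v v = r \<cdot>\<^sub>v v"
proof -
  define y where "y = C *\<^sub>v v - r \<cdot>\<^sub>v v"
  have y: "y \<in> carrier_vec n" unfolding y_def using C v by simp
  have sym: "C\<^sup>T = C" using C by (simp add: psd_mat_def)
  have "y = 0\<^sub>v n"
  proof (cases "r = 0")
    case True
    then have yC: "y = C *\<^sub>v v" unfolding y_def using C v by (intro eq_vecI) auto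
    have "y \<bullet> y = v \<bullet> (C *\<^sub>v (C *\<^sub>v v))"
      unfolding yC using scalar_prod_mult_mat_vec_transpose[OF C(1) v, of "C *\<^sub>v v"] C v sym by simp
    also have "\<dots> = 0" unfolding eig True using v by simp
    finally show ?thesis using scalar_prod_self_pos[OF y] by force
  next
    case False
    have "C *\<^sub>v y = C *\<^sub>v (C *\<^sub>v v) - r \<cdot>\<^sub>v (C *\<^sub>v v)"
      unfolding y_def using C v by (simp add: mult_minus_distrib_mat_vec[of _ n n] mult_mat_vec[of _ n n])
    also have "\<dots> = - r \<cdot>\<^sub>v y"
      unfolding eig y_def using C v by (intro eq_vecI) (auto simp: power2_eq_square algebra_simps simp del: index_mult_mat_vec)
    finally have "y \<bullet> (C *\<^sub>v y) = - r * (y \<bullet> y)" using y by simp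
    moreover have "0 \<le> y \<bullet> (C *\<^sub>v y)" using C y by (auto simp: psd_mat_def)
    ultimately have "\<not> 0 < y \<bullet> y" using r False by (simp add: mult_le_0_iff not_less)
    then show ?thesis using scalar_prod_self_pos[OF y] by blast
  qed
  then have "(C *\<^sub>v v - r \<cdot>\<^sub>v v) $ i = 0" if "i < n" for i unfolding y_def using that by simp
  then show ?thesis using C v by (intro eq_vecI) (auto simp del: index_mult_mat_vec)
qed

text \<open>The definite description in \<open>psd_sqrt\<close> calls for uniqueness as well as
  existence. By \<open>psd_mat_eigenvector_of_square\<close>, any semidefinite root \<open>C\<close>
  acts on the columns of \<open>Q\<close> as the candidate does, and those columns form a
  basis.\<close>

lemma psd_sqrt_orthogonal_diag:
  fixes Q :: "real mat"
  assumes Q: "Q \<in> carrier_mat n n" "Q\<^sup>T * Q = 1\<^sub>m n" and d: "\<And>i. i < n \<Longrightarrow> 0 \<le> d i"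
  shows "psd_sqrt (Q * mat_diag n d * Q\<^sup>T) = Q * mat_diag n (\<lambda>i. sqrt (d i)) * Q\<^sup>T"
    (is "psd_sqrt ?M = ?B")
  unfolding psd_sqrt_def
proof (rule the_equality)
  note as = assoc_mult_mat[of _ n n _ n _ n]
  have cl: "X * Y \<in> carrier_mat n n" if "X \<in> carrier_mat n n" "Y \<in> carrier_mat n n" for X Y :: "real mat"
    using that by (rule mult_carrier_mat)
  have QQ: "Q * Q\<^sup>T = 1\<^sub>m n" using Q mat_mult_left_right_inverse[of "Q\<^sup>T" n Q] by simp
  have QT: "Q\<^sup>T \<in> carrier_mat n n" using Q by simp
  have conj: "(Q * mat_diag n e * Q\<^sup>T) * (Q * mat_diag n e' * Q\<^sup>T) = Q * mat_diag n (\<lambda>i. e i * e' i) * Q\<^sup>T" for e e'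
  proof -
    have "(Q * mat_diag n e * Q\<^sup>T) * (Q * mat_diag n e' * Q\<^sup>T) =
        Q * (mat_diag n e * ((Q\<^sup>T * Q) * (mat_diag n e' * Q\<^sup>T)))"
      using Q(1) QT by (simp add: as cl)
    also have "\<dots> = Q * ((mat_diag n e * mat_diag n e') * Q\<^sup>T)"
      unfolding Q(2) left_mult_one_mat[OF cl[OF mat_diag_dim QT]]
      using Q(1) QT by (simp add: as del: mat_diag_diag)
    also have "\<dots> = Q * mat_diag n (\<lambda>i. e i * e' i) * Q\<^sup>T" using Q(1) QT by (simp add: as)
    finally show ?thesis .
  qed
  have sqd: "mat_diag n (\<lambda>i. sqrt (d i) * sqrt (d i)) = mat_diag n d"
    using d by (intro eq_matI) (auto simp: mat_diag_def)
  have BB: "?B * ?B = ?M" unfolding conj sqd ..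
  then show "psd_mat ?B \<and> ?B * ?B = ?M" using psd_mat_orthogonal_diag[OF Q(1)] d by simp
  fix C assume C: "psd_mat C \<and> C * C = ?M"
  have M: "?M \<in> carrier_mat n n" using Q(1) QT by (simp add: cl)
  have B: "?B \<in> carrier_mat n n" using Q(1) QT by (simp add: cl)
  have Cc: "C \<in> carrier_mat n n"
  proof -
    have "dim_row C = n" using C M by (metis carrier_matD(1) index_mult_mat(2))
    then show ?thesis using C by (auto simp: psd_mat_def)
  qed
  have diag: "(Q * mat_diag n e * Q\<^sup>T) *\<^sub>v (Q *\<^sub>v unit_vec n j) = e j \<cdot>\<^sub>v (Q *\<^sub>v unit_vec n j)" if j: "j < n" for e j
  proof -
    have "(Q * mat_diag n e * Q\<^sup>T) *\<^sub>v (Q *\<^sub>v unit_vec n j) =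
        Q *\<^sub>v (mat_diag n e *\<^sub>v ((Q\<^sup>T * Q) *\<^sub>v unit_vec n j))"
      using Q(1) QT by (simp add: assoc_mult_mat_vec[of _ n n _ n] cl)
    also have "\<dots> = Q *\<^sub>v (mat_diag n e *\<^sub>v unit_vec n j)" unfolding Q(2) by simp
    also have "mat_diag n e *\<^sub>v unit_vec n j = e j \<cdot>\<^sub>v unit_vec n j"
      using j mult_mat_diag_vec_index[of "unit_vec n j" n _ e]
      by (intro eq_vecI) (auto simp del: index_mult_mat_vec simp: mat_diag_def)
    finally show ?thesis using Q(1) by (simp add: mult_mat_vec)
  qed
  have col: "C *\<^sub>v (Q *\<^sub>v unit_vec n j) = ?B *\<^sub>v (Q *\<^sub>v unit_vec n j)" if j: "j < n" for j
  proof -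
    have "C *\<^sub>v (C *\<^sub>v (Q *\<^sub>v unit_vec n j)) = ?M *\<^sub>v (Q *\<^sub>v unit_vec n j)"
      unfolding conjunct2[OF C, symmetric]
      by (rule assoc_mult_mat_vec[symmetric, OF Cc Cc]) (use Q(1) in simp)
    also have "\<dots> = (sqrt (d j))\<^sup>2 \<cdot>\<^sub>v (Q *\<^sub>v unit_vec n j)" unfolding diag[OF j] using d[OF j] by simp
    finally have "C *\<^sub>v (Q *\<^sub>v unit_vec n j) = sqrt (d j) \<cdot>\<^sub>v (Q *\<^sub>v unit_vec n j)"
      using C Cc Q(1) d[OF j] by (intro psd_mat_eigenvector_of_square[of C n]) auto
    then show ?thesis unfolding diag[OF j] .
  qed
  have "C * Q = ?B * Q"
  proof (rule eq_matI)
    fix i j assume "i < dim_row (?B * Q)" "j < dim_col (?B * Q)"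
    then have ij: "i < n" "j < n" using B Q(1) by auto
    have "(C * Q) *\<^sub>v unit_vec n j = (?B * Q) *\<^sub>v unit_vec n j"
      unfolding assoc_mult_mat_vec[OF Cc Q(1) unit_vec_carrier]
        assoc_mult_mat_vec[OF B Q(1) unit_vec_carrier] by (rule col[OF ij(2)])
    moreover have "(X *\<^sub>v unit_vec n j) $ i = X $$ (i,j)" if "X \<in> carrier_mat n n" for X :: "real mat"
      using that ij by simp
    ultimately show "(C * Q) $$ (i,j) = (?B * Q) $$ (i,j)"
      using cl[OF Cc Q(1)] cl[OF B Q(1)] by metis
  qed (use Cc B Q in auto)
  then have "C * Q * Q\<^sup>T = ?B * Q * Q\<^sup>T" by simp
  then show "C = ?B" using Cc B Q(1) QT QQ by (simp add: as)
qed

lemma mset_singular_values: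
  fixes A :: "real mat"
  assumes Q: "Q \<in> carrier_mat m m" "Q\<^sup>T * Q = 1\<^sub>m m" and AA: "A\<^sup>T * A = Q * mat_diag m d * Q\<^sup>T"
    and d: "\<And>i. i < m \<Longrightarrow> 0 \<le> d i"
  shows "mset (singular_values A) = image_mset (\<lambda>i. sqrt (d i)) (mset_set {..<m})"
proof -
  have "psd_sqrt (A\<^sup>T * A) = Q * mat_diag m (\<lambda>i. sqrt (d i)) * Q\<^sup>T"
    unfolding AA by (rule psd_sqrt_orthogonal_diag[OF Q]) (rule d)
  then have "mset (singular_values A) = proots (\<Prod>i<m. [:- sqrt (d i), 1:])"
    unfolding singular_values_def by (simp add: char_poly_orthogonal_diag[OF Q refl])
  also have "\<dots> = (\<Sum>i<m. {#sqrt (d i)#})" by (subst proots_prod) auto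
  also have "\<dots> = image_mset (\<lambda>i. sqrt (d i)) (mset_set {..<m})" by (induction m) (auto simp: lessThan_Suc)
  finally show ?thesis .
qed

text \<open>Each \<open>d i\<close> is the squared length of \<open>A\<close> applied to the
  \<open>i\<close>-th column of \<open>Q\<close>, hence nonnegative; if all vanished, every column
  of \<open>A\<close> would have length zero. The singular values are recorded as a multiset because
  later uses do not depend on their order.\<close>

lemma gram_eigenvalues:
  fixes A :: "real mat"
  assumes A: "A \<in> carrier_mat n m"
  obtains Q d where "Q \<in> carrier_mat m m" "Q\<^sup>T * Q = 1\<^sub>m m" "A\<^sup>T * A = Q * mat_diag m d * Q\<^sup>T"
    "\<And>i. i < m \<Longrightarrow> 0 \<le> d i" "mset (singular_values A) = image_mset (\<lambda>i. sqrt (d i)) (mset_set {..<m})"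
    "A \<noteq> 0\<^sub>m n m \<Longrightarrow> \<exists>i<m. 0 < d i"
proof -
  have G: "A\<^sup>T * A \<in> carrier_mat m m" "(A\<^sup>T * A)\<^sup>T = A\<^sup>T * A"
    using A by (auto simp: transpose_mult[of _ m n])
  obtain Q d where Q: "Q \<in> carrier_mat m m" "Q\<^sup>T * Q = 1\<^sub>m m" and GQ: "A\<^sup>T * A = Q * mat_diag m d * Q\<^sup>T"
    using real_spectral_theorem[OF G] .
  have form: "v \<bullet> ((A\<^sup>T * A) *\<^sub>v v) = (A *\<^sub>v v) \<bullet> (A *\<^sub>v v)" if "v \<in> carrier_vec m" for v
    using scalar_prod_mult_mat_vec_transpose[of "A\<^sup>T" m n v "A *\<^sub>v v"] A that
    by (simp add: assoc_mult_mat_vec[of _ m n _ m])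
  have d: "0 \<le> d i" if i: "i < m" for i
  proof -
    define v where "v = Q *\<^sub>v unit_vec m i"
    have v: "v \<in> carrier_vec m" unfolding v_def using Q by simp
    have "Q\<^sup>T *\<^sub>v v = (Q\<^sup>T * Q) *\<^sub>v unit_vec m i"
      unfolding v_def using Q(1) by (simp add: assoc_mult_mat_vec[of _ m m _ m])
    then have Qv: "Q\<^sup>T *\<^sub>v v = unit_vec m i" using Q by simp
    have "d i = v \<bullet> ((A\<^sup>T * A) *\<^sub>v v)"
      unfolding quadratic_form_orthogonal_diag[OF Q(1) GQ v] Qv by (simp add: sum_mult_unit_vec_sq[OF i])
    then show ?thesis unfolding form[OF v] by (simp add: scalar_prod_self_nonneg)
  qed
  have pos: "\<exists>i<m. 0 < d i" if "A \<noteq> 0\<^sub>m n m"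
  proof (rule ccontr)
    assume "\<not> ?thesis"
    then have d0: "d i = 0" if "i < m" for i using d[OF that] that by force
    have "A $$ (i,j) = 0" if ij: "i < n" "j < m" for i j
    proof -
      have "(A *\<^sub>v unit_vec m j) \<bullet> (A *\<^sub>v unit_vec m j) = 0"
        unfolding form[OF unit_vec_carrier, symmetric]
          quadratic_form_orthogonal_diag[OF Q(1) GQ unit_vec_carrier] using d0 by simp
      then have "A *\<^sub>v unit_vec m j = 0\<^sub>v n"
        using scalar_prod_self_pos[of "A *\<^sub>v unit_vec m j" n] A by force
      from arg_cong[OF this, of "\<lambda>v. v $ i"] show ?thesis using A ij by simp
    qed
    then have "A = 0\<^sub>m n m" using A by (intro eq_matI) auto
    then show False using that by simp
  qed
  show thesis by (rule that[OF Q GQ d mset_singular_values[OF Q GQ d] pos])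
qed

text \<open>One coercivity bound gives both facts required: injectivity when applied to a
  difference, and the norm estimate when applied to the preimage of a point of the unit
  ball.\<close>

lemma inv_restrict_norm_le:
  fixes A :: "real mat"
  assumes c: "0 < c" and fin: "finite \<sigma>"
    and bound: "\<And>a. c * (\<Sum>j\<in>\<sigma>. (a j)\<^sup>2) \<le> restrict_op A \<sigma> a \<bullet> restrict_op A \<sigma> a"
  shows "inv_restrict_norm A \<sigma> \<le> ereal (1 / sqrt c)"
proof -
  have diff: "restrict_op A \<sigma> (\<lambda>j. a j - a' j) = restrict_op A \<sigma> a - restrict_op A \<sigma> a'" for a a'
  proof -
    have "coord_incl (dim_col A) \<sigma> (\<lambda>j. a j - a' j) = coord_incl (dim_col A) \<sigma> a - coord_incl (dim_col A) \<sigma> a'"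
      by (intro eq_vecI) (auto simp: coord_incl_def)
    then show ?thesis unfolding restrict_op_def
      by (simp add: mult_minus_distrib_mat_vec[of _ "dim_row A" "dim_col A"] coord_incl_def)
  qed
  have inj: "inj_on (restrict_op A \<sigma>) (coord_space \<sigma>)"
  proof (rule inj_onI)
    fix a a' assume a: "a \<in> coord_space \<sigma>" "a' \<in> coord_space \<sigma>" and eq: "restrict_op A \<sigma> a = restrict_op A \<sigma> a'"
    have "restrict_op A \<sigma> (\<lambda>j. a j - a' j) = 0\<^sub>v (dim_row A)"
      unfolding diff eq by (auto simp: restrict_op_def)
    then have "c * (\<Sum>j\<in>\<sigma>. (a j - a' j)\<^sup>2) \<le> 0" using bound[of "\<lambda>j. a j - a' j"] by simp
    then have "(\<Sum>j\<in>\<sigma>. (a j - a' j)\<^sup>2) \<le> 0" using c by (simp add: mult_le_0_iff)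
    then have "(\<Sum>j\<in>\<sigma>. (a j - a' j)\<^sup>2) = 0" by (intro antisym sum_nonneg) auto
    then have "\<forall>j\<in>\<sigma>. a j = a' j" using fin by (simp add: sum_nonneg_eq_0_iff)
    then show "a = a'" using a by (intro PiE_ext) auto
  qed
  have le: "coord_norm2 \<sigma> (inv_into (coord_space \<sigma>) (restrict_op A \<sigma>) y) \<le> 1 / sqrt c"
    if y: "y \<in> restrict_op A \<sigma> ` coord_space \<sigma>" "vec_norm2 y \<le> 1" for y
  proof -
    obtain a where a: "a \<in> coord_space \<sigma>" "y = restrict_op A \<sigma> a" using y by blast
    have "c * (\<Sum>j\<in>\<sigma>. (a j)\<^sup>2) \<le> y \<bullet> y" unfolding a(2) by (rule bound)
    also have "\<dots> \<le> 1" using y(2) by (simp add: vec_norm2_def)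
    finally have "(\<Sum>j\<in>\<sigma>. (a j)\<^sup>2) \<le> 1 / c" using c by (simp add: field_simps)
    then have "coord_norm2 \<sigma> a \<le> sqrt (1 / c)" unfolding coord_norm2_def by (rule real_sqrt_le_mono)
    then show ?thesis unfolding a(2) inv_into_f_f[OF inj a(1)] by (simp add: real_sqrt_divide)
  qed
  show ?thesis unfolding inv_restrict_norm_def if_P[OF inj]
  proof (rule SUP_least)
    fix y assume "y \<in> {y \<in> restrict_op A \<sigma> ` coord_space \<sigma>. vec_norm2 y \<le> 1}"
    then show "ereal (coord_norm2 \<sigma> (inv_into (coord_space \<sigma>) (restrict_op A \<sigma>) y)) \<le> ereal (1 / sqrt c)"
      using le[of y] unfolding ereal_less_eq by blast
  qed
qed

text \<open>The barrier starts at \<open>- s\<close>, where the potential of the Gram spectrum is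
  \<open>U\<close> with \<open>s * U = m - N\<close>, and \<open>N\<close> is the sum in the
  hypothesis. After \<open>m - k\<close> deletions it stands at \<open>(N - k) / U\<close>, which is
  at least \<open>c\<close> because \<open>U \<le> m / s\<close>.\<close>

lemma restricted_invertibility_resolvent:
  fixes A :: "real mat"
  assumes A: "A \<in> carrier_mat n m" and Q: "Q \<in> carrier_mat m m" "Q\<^sup>T * Q = 1\<^sub>m m"
    and AA: "A\<^sup>T * A = Q * mat_diag m d * Q\<^sup>T" and d: "\<And>i. i < m \<Longrightarrow> 0 \<le> d i"
    and s: "0 < s" and k: "0 < k" "real k < (\<Sum>i<m. d i / (d i + s))"
  defines "c \<equiv> s * ((\<Sum>i<m. d i / (d i + s)) - real k) / real m"
  shows "\<exists>\<sigma>\<subseteq>{..<m}. card \<sigma> = k \<and> inv_restrict_norm A \<sigma> \<le> ereal (1 / sqrt c)"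
proof -
  define N where "N = (\<Sum>i<m. d i / (d i + s))"
  define U where "U = (\<Sum>i<m. 1 / (d i + s))"
  have m: "0 < m" using k by (cases m) auto
  have G: "A\<^sup>T * A \<in> carrier_mat m m" "(A\<^sup>T * A)\<^sup>T = A\<^sup>T * A"
    using A by (auto simp: transpose_mult[of _ m n])
  have ds: "0 < d i + s" if "i < m" for i using d[OF that] s by simp
  have U: "0 < U" unfolding U_def using m ds by (intro sum_pos) auto
  have NU: "s * U = real m - N"
  proof -
    have "s * U = (\<Sum>i<m. 1 - d i / (d i + s))"
      unfolding U_def sum_distrib_left
    proof (intro sum.cong refl)
      fix i assume "i \<in> {..<m}"
      then have "d i + s \<noteq> 0" using ds by force
      then show "s * (1 / (d i + s)) = 1 - d i / (d i + s)" by (simp add: field_simps)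
    qed
    then show ?thesis by (simp add: N_def sum_subtractf)
  qed
  have Nm: "N < real m" using NU s U by (smt (verit) mult_pos_pos)
  have km: "k \<le> m" using k(2) Nm unfolding N_def by linarith
  have cp: "char_poly (A\<^sup>T * A) = (\<Prod>i<m. [:- d i, 1:])" by (rule char_poly_orthogonal_diag[OF Q AA])
  have roots: "- s < x" if "poly (char_poly (A\<^sup>T * A)) x = 0" for x
    using that d s unfolding cp poly_linear_factors_eq_0_iff by force
  have barrier: "- poly (pderiv (char_poly (A\<^sup>T * A))) (- s) / poly (char_poly (A\<^sup>T * A)) (- s) \<le> U"
  proof -
    have "poly (pderiv (char_poly (A\<^sup>T * A))) (- s) =
        poly (char_poly (A\<^sup>T * A)) (- s) * (\<Sum>i<m. 1 / (- s - d i))"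
      unfolding cp using ds by (intro poly_pderiv_linear_factors) force
    also have "(\<Sum>i<m. 1 / (- s - d i)) = - U"
      unfolding U_def sum_negf[symmetric] by (intro sum.cong) (auto simp: minus_divide_right)
    finally show ?thesis using roots[of "- s"] by auto
  qed
  obtain f where f: "inj_on f {..<k}" "f ` {..<k} \<subseteq> {..<m}"
    "\<forall>x. poly (char_poly (principal_submatrix (A\<^sup>T * A) k f)) x = 0 \<longrightarrow> - s + real (m - k) / U < x"
    using exists_principal_submatrix_roots_gt[OF G U roots barrier k(1) km] by blast
  have c0: "0 < c" unfolding c_def using s k m by simp
  have cU: "c \<le> - s + real (m - k) / U"
  proof -
    have "- s + real (m - k) / U = (N - real k) / U"
      using U NU km by (simp add: field_simps of_nat_diff)
    moreover have "c = (N - real k) / (real m / s)" unfolding c_def N_def using s by simp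
    moreover have "U \<le> real m / s"
    proof -
      have "0 \<le> N" unfolding N_def using d ds by (intro sum_nonneg) (auto simp: less_imp_le)
      then show ?thesis using NU s by (simp add: field_simps)
    qed
    ultimately show ?thesis using U k(2) m s unfolding N_def[symmetric]
      by (simp only:) (intro divide_left_mono, auto)
  qed
  define \<sigma> where "\<sigma> = f ` {..<k}"
  have form: "\<forall>v\<in>carrier_vec k. v \<noteq> 0\<^sub>v k \<longrightarrow>
      (- s + real (m - k) / U) * (v \<bullet> v) < v \<bullet> (principal_submatrix (A\<^sup>T * A) k f *\<^sub>v v)"
    by (rule iffD1[OF char_poly_roots_gt_iff_quadratic_form f(3)])
      (rule principal_submatrix_carrier transpose_principal_submatrix[OF G f(2)])+
  have qf: "c * (v \<bullet> v) \<le> v \<bullet> (principal_submatrix (A\<^sup>T * A) k f *\<^sub>v v)" if v: "v \<in> carrier_vec k" for v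
  proof (cases "v = 0\<^sub>v k")
    case True
    moreover have "principal_submatrix (A\<^sup>T * A) k f *\<^sub>v 0\<^sub>v k \<in> carrier_vec k"
      by (intro mult_mat_vec_carrier[of _ k k]) auto
    ultimately show ?thesis by simp
  next
    case False
    have "(- s + real (m - k) / U) * (v \<bullet> v) < v \<bullet> (principal_submatrix (A\<^sup>T * A) k f *\<^sub>v v)"
      using bspec[OF form v] False by (rule mp)
    moreover have "c * (v \<bullet> v) \<le> (- s + real (m - k) / U) * (v \<bullet> v)"
      using cU by (intro mult_right_mono) (auto simp: scalar_prod_self_nonneg)
    ultimately show ?thesis by linarith
  qed
  have "inv_restrict_norm A \<sigma> \<le> ereal (1 / sqrt c)"
  proof (rule inv_restrict_norm_le[OF c0])
    show "finite \<sigma>" by (simp add: \<sigma>_def)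
    fix a
    define w where "w = coord_incl m \<sigma> a"
    have w: "w \<in> carrier_vec m" by (simp add: w_def coord_incl_def)
    have "(\<Sum>j\<in>\<sigma>. (a j)\<^sup>2) = vec k (a \<circ> f) \<bullet> vec k (a \<circ> f)"
      unfolding \<sigma>_def by (subst sum.reindex[OF f(1)])
        (simp add: scalar_prod_def atLeast0LessThan power2_eq_square)
    then have "c * (\<Sum>j\<in>\<sigma>. (a j)\<^sup>2) \<le> w \<bullet> ((A\<^sup>T * A) *\<^sub>v w)"
      using qf[of "vec k (a \<circ> f)"] quadratic_form_coord_incl[OF G(1) f(1,2), of a]
      by (simp add: w_def \<sigma>_def)
    also have "\<dots> = (A *\<^sub>v w) \<bullet> (A *\<^sub>v w)"
      using scalar_prod_mult_mat_vec_transpose[of "A\<^sup>T" m n w "A *\<^sub>v w"] A w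
      by (simp add: assoc_mult_mat_vec[of _ m n _ m])
    also have "A *\<^sub>v w = restrict_op A \<sigma> a" using A by (simp add: restrict_op_def w_def)
    finally show "c * (\<Sum>j\<in>\<sigma>. (a j)\<^sup>2) \<le> restrict_op A \<sigma> a \<bullet> restrict_op A \<sigma> a" .
  qed
  moreover have "card \<sigma> = k" unfolding \<sigma>_def using card_image[OF f(1)] by simp
  ultimately show ?thesis using f(2) unfolding \<sigma>_def by blast
qed

section \<open>Choice of the resolvent parameter\<close>

text \<open>The tangent of \<open>ln\<close> at \<open>2\<close> leaves
  \<open>ln 2 \<le> 15 / 34 * z\<close> to check, worst at \<open>z = 2\<close>, where
  \<open>ln 2 \<le> 0.85\<close> suffices. The factor \<open>16 / 17\<close> is the cost of
  replacing \<open>x\<close> by \<open>x + \<theta>\<close> when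
  \<open>16 * \<theta> \<le> x\<close>.\<close>

lemma one_plus_ln_le:
  fixes z :: real assumes "2 \<le> z" shows "1 + ln z \<le> 16 / 17 * z"
proof -
  have "1 + ln z = 1 + ln 2 + ln (z / 2)" using assms by (simp add: ln_div)
  also have "ln (z / 2) \<le> z / 2 - 1" using assms by (intro ln_le_minus_one) auto
  finally have "1 + ln z \<le> ln 2 + z / 2" by simp
  moreover have "ln 2 \<le> (0.85::real)"
  proof -
    have "sqrt 2 \<le> (1.42::real)" by (intro real_le_lsqrt) (auto simp: power2_eq_square)
    moreover have "ln (sqrt 2) \<le> sqrt 2 - (1::real)" by (rule ln_le_minus_one) simp
    ultimately show ?thesis by (simp add: ln_sqrt)
  qed
  ultimately show ?thesis using assms by auto
qed

lemma one_minus_powr_le: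
  fixes x q :: real assumes "0 < x"
  shows "1 - x powr q \<le> q * (- ln x)"
proof -
  have "x powr q = exp (q * ln x)" using assms by (simp add: powr_def)
  then show ?thesis using exp_ge_add_one_self[of "q * ln x"] by linarith
qed

text \<open>Replaces \<open>(1 - x powr q) / q\<close>, which stays bounded as \<open>x\<close> tends to \<open>0\<close>, by a
  resolvent; this is where the regularisation \<open>\<theta>\<close> must be small compared with \<open>q\<close>.\<close>

lemma resolvent_ge_one_minus_powr:
  fixes x q \<theta> :: real
  assumes x: "0 \<le> x" and q: "0 < q" "q \<le> 1" and \<theta>: "0 < \<theta>" "\<theta> \<le> q / 34"
  shows "1 / (x + \<theta>) \<ge> 1 + (1 - x powr q) / q - 4 * \<theta>"
proof -
  \<comment> \<open>Near zero, \<open>x + \<theta> < 17 * \<theta> \<le> q / 2\<close>, so the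
    resolvent exceeds \<open>2 / q\<close>. In the middle range the slack in
    \<open>one_plus_ln_le\<close> absorbs the shift by \<open>\<theta>\<close>. From
    \<open>1/2\<close> on there is no slack at \<open>x = 1\<close>, and the term
    \<open>4 * \<theta>\<close> pays for the shift.\<close>
  consider "x < 16 * \<theta>" | "16 * \<theta> \<le> x" "x < 1/2" | "1/2 \<le> x" by linarith
  then show ?thesis
  proof cases
    case 1
    have "(1 - x powr q) / q \<le> 1 / q" using q by (intro divide_right_mono) auto
    moreover have "1 \<le> 1 / q" using q by simp
    ultimately have "1 + (1 - x powr q) / q - 4 * \<theta> \<le> 1 / q + 1 / q" using \<theta> by linarith
    also have "\<dots> = 1 / (17 * (q / 34))" using q by simp
    also have "\<dots> \<le> 1 / (x + \<theta>)" using 1 x \<theta> by (intro divide_left_mono) auto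
    finally show ?thesis .
  next
    case 2
    have xpos: "x > 0" using 2 \<theta> by linarith
    have "(1 - x powr q) / q \<le> ln (1 / x)"
      using one_minus_powr_le[of x q] xpos q by (simp add: ln_div field_simps)
    moreover have "1 + ln (1 / x) \<le> 16 / 17 * (1 / x)"
      using 2 xpos by (intro one_plus_ln_le) (simp add: field_simps)
    moreover have "16 / 17 * (1 / x) \<le> 1 / (x + \<theta>)"
      using 2 xpos \<theta> by (simp add: field_simps)
    ultimately show ?thesis using \<theta> by linarith
  next
    case 3
    have xpos: "x > 0" using 3 by linarith
    have "(1 - x powr q) / q \<le> ln (1 / x)"
      using one_minus_powr_le[of x q] xpos q by (simp add: ln_div field_simps)
    also have "\<dots> \<le> 1 / x - 1" using xpos by (intro ln_le_minus_one) auto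
    finally have a: "1 + (1 - x powr q) / q \<le> 1 / x" by simp
    have "1 / x - 1 / (x + \<theta>) = \<theta> * (1 / (x * (x + \<theta>)))"
      using xpos \<theta> by (simp add: field_simps)
    also have "1 / (x * (x + \<theta>)) \<le> 1 / (1/2 * (1/2))"
      using 3 \<theta> by (intro divide_left_mono mult_mono) auto
    finally have "1 / x - 1 / (x + \<theta>) \<le> 4 * \<theta>" using \<theta> by simp
    then show ?thesis using a by linarith
  qed
qed

text \<open>The pointwise inequality is averaged at \<open>\<kappa> * d i / F\<close> with weights
  \<open>d i\<close>. The moment hypothesis yields a relative gain \<open>\<eta>\<close>, of which
  at most half is lost to the error \<open>4 * \<theta>\<close>.\<close>

lemma exists_resolvent_ge:
  fixes d :: "'a \<Rightarrow> real" and q \<kappa> F :: real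
  assumes d: "\<And>i. i \<in> I \<Longrightarrow> 0 \<le> d i" and F: "F = sum d I" "0 < F"
    and q: "0 < q" "q \<le> 1" and \<kappa>: "0 < \<kappa>"
    and moment: "(\<Sum>i\<in>I. d i * (\<kappa> * d i / F) powr q) \<le> (1 - q * \<eta>) * F"
    and \<theta>: "0 < \<theta>" "\<theta> \<le> q / 34" "\<theta> \<le> \<eta> / 8"
  shows "\<exists>s>0. s * ((\<Sum>i\<in>I. d i / (d i + s)) - \<kappa>) \<ge> \<theta> * \<eta> / 2 * F"
proof (intro exI conjI)
  \<comment> \<open>With this scaling \<open>\<kappa> * d i / F + \<theta>\<close> equals
    \<open>\<kappa> / F * (d i + s)\<close>, so \<open>\<theta>\<close> becomes the shift
    \<open>s\<close> of the spectrum.\<close>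
  define s where "s = \<theta> * F / \<kappa>"
  show s: "0 < s" unfolding s_def using \<theta> F \<kappa> by simp
  have "(1 + \<eta> - 4 * \<theta>) * F \<le> (\<Sum>i\<in>I. d i * (1 + 1 / q - 4 * \<theta>)) - 1 / q * ((1 - q * \<eta>) * F)"
    using q unfolding sum_distrib_right[symmetric] F(1)[symmetric] by (simp add: field_simps)
  also have "\<dots> \<le> (\<Sum>i\<in>I. d i * (1 + 1 / q - 4 * \<theta>)) - 1 / q * (\<Sum>i\<in>I. d i * (\<kappa> * d i / F) powr q)"
    using q moment by (intro diff_left_mono mult_left_mono) auto
  also have "\<dots> = (\<Sum>i\<in>I. d i * (1 + (1 - (\<kappa> * d i / F) powr q) / q - 4 * \<theta>))"
    unfolding sum_distrib_left sum_subtractf[symmetric]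
    by (intro sum.cong) (use q in \<open>auto simp: field_simps\<close>)
  also have "\<dots> \<le> (\<Sum>i\<in>I. d i * (1 / (\<kappa> * d i / F + \<theta>)))"
    using d F \<kappa> q \<theta> by (intro sum_mono mult_left_mono resolvent_ge_one_minus_powr) auto
  also have "\<dots> = (\<Sum>i\<in>I. F / \<kappa> * (d i / (d i + s)))"
  proof (intro sum.cong refl)
    fix i assume "i \<in> I"
    then have "d i + s > 0" using d s by (simp add: add_nonneg_pos)
    moreover have "\<kappa> * d i / F + \<theta> = \<kappa> / F * (d i + s)"
      unfolding s_def using \<kappa> F(2) by (simp add: field_simps)
    ultimately show "d i * (1 / (\<kappa> * d i / F + \<theta>)) = F / \<kappa> * (d i / (d i + s))"
      using \<kappa> F(2) by (simp add: field_simps)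
  qed
  also have "\<dots> = F / \<kappa> * (\<Sum>i\<in>I. d i / (d i + s))" by (simp add: sum_distrib_left)
  finally have "\<kappa> / F * ((1 + \<eta> - 4 * \<theta>) * F) \<le> \<kappa> / F * (F / \<kappa> * (\<Sum>i\<in>I. d i / (d i + s)))"
    using \<kappa> F(2) by (intro mult_left_mono) auto
  then have *: "\<kappa> * (1 + \<eta> - 4 * \<theta>) \<le> (\<Sum>i\<in>I. d i / (d i + s))"
    using \<kappa> F(2) by simp
  have "\<theta> * \<eta> / 2 * F = s * (\<kappa> * (\<eta> / 2))" unfolding s_def using \<kappa> by simp
  also have "\<dots> \<le> s * (\<kappa> * (\<eta> - 4 * \<theta>))" using s \<kappa> \<theta> by (intro mult_left_mono) auto
  also have "\<dots> \<le> s * ((\<Sum>i\<in>I. d i / (d i + s)) - \<kappa>)"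
    using s * by (intro mult_left_mono) (auto simp: algebra_simps)
  finally show "\<theta> * \<eta> / 2 * F \<le> s * ((\<Sum>i\<in>I. d i / (d i + s)) - \<kappa>)" .
qed

text \<open>Bernoulli's inequality for real exponents, solved for \<open>x\<close>. It is the
  weighted mean inequality for \<open>x powr a\<close> and \<open>1\<close> with weights
  \<open>1 / a\<close> and \<open>1 - 1 / a\<close>, derived from the concavity of
  \<open>ln\<close>.\<close>

lemma le_one_plus_powr:
  fixes x a :: real
  assumes x: "0 \<le> x" and a: "1 \<le> a"
  shows "x \<le> 1 + (x powr a - 1) / a"
proof (cases "x = 0")
  case True
  then show ?thesis using a by simp
next
  case False
  define Y L where "Y = x powr a" and "L = 1 + (Y - 1) / a"
  have Y: "0 < Y" using False by (simp add: Y_def)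
  have L_eq: "L = (1 - 1 / a) + Y / a" unfolding L_def using a by (simp add: field_simps)
  have L: "0 < L" unfolding L_eq using Y a by (intro add_nonneg_pos) auto
  have "1 / a * (ln Y - ln L) + (1 - 1 / a) * (ln 1 - ln L) \<le> 1 / a * (Y / L - 1) + (1 - 1 / a) * (1 / L - 1)"
    using Y L a ln_le_minus_one[of "Y / L"] ln_le_minus_one[of "1 / L"]
    by (intro add_mono mult_left_mono) (auto simp: ln_div)
  also have "\<dots> = (Y / a + (1 - 1 / a)) / L - 1"
    using L a by (simp add: field_simps)
  also have "\<dots> = 0" using L unfolding L_eq by simp
  finally have "ln Y / a \<le> ln L" by (simp add: algebra_simps)
  moreover have "ln Y / a = ln x" using a False x by (simp add: Y_def)
  ultimately have "x \<le> L" using L x False by simp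
  then show ?thesis by (simp add: L_def Y_def)
qed

text \<open>A power mean inequality with unnormalised weights: \<open>le_one_plus_powr\<close>,
  applied termwise to \<open>V i / \<delta>\<close>, bounds the weighted average of these quotients
  by \<open>1\<close>.\<close>

lemma moment_one_le:
  fixes d V :: "'a \<Rightarrow> real"
  assumes d: "\<And>i. i \<in> I \<Longrightarrow> 0 \<le> d i" and V: "\<And>i. i \<in> I \<Longrightarrow> 0 \<le> V i" and \<delta>: "0 < \<delta>" and q: "1 \<le> q"
    and moment: "(\<Sum>i\<in>I. d i * V i powr q) \<le> \<delta> powr q * sum d I"
  shows "(\<Sum>i\<in>I. d i * V i) \<le> \<delta> * sum d I"
proof -
  have "(\<Sum>i\<in>I. d i * (V i / \<delta>)) \<le> (\<Sum>i\<in>I. d i * (1 + ((V i / \<delta>) powr q - 1) / q))"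
    using d V \<delta> q by (intro sum_mono mult_left_mono le_one_plus_powr) auto
  also have "\<dots> = (\<Sum>i\<in>I. d i + d i * V i powr q / \<delta> powr q / q - d i / q)"
    using V \<delta> by (intro sum.cong refl) (simp add: powr_divide algebra_simps diff_divide_distrib)
  also have "\<dots> = sum d I + (\<Sum>i\<in>I. d i * V i powr q) / \<delta> powr q / q - sum d I / q"
    by (simp add: sum.distrib sum_subtractf sum_divide_distrib)
  also have "(\<Sum>i\<in>I. d i * V i powr q) / \<delta> powr q / q \<le> sum d I / q"
    using moment \<delta> q by (intro divide_right_mono) (auto simp: divide_le_eq ac_simps)
  finally have "(\<Sum>i\<in>I. d i * (V i / \<delta>)) \<le> sum d I" by simp
  then have "(\<Sum>i\<in>I. d i * V i) / \<delta> \<le> sum d I" by (simp add: sum_divide_distrib)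
  then show ?thesis using \<delta> by (simp add: divide_le_eq ac_simps)
qed

text \<open>The quantity is of order \<open>\<epsilon>\<^sup>2\<close> for small
  \<open>\<epsilon>\<close> and of order \<open>- ln (1 - \<epsilon>)\<close> near one. The linear
  bound serves when \<open>\<theta>\<close> is limited by the exponent, the quadratic one when it is
  limited by \<open>\<eta>\<close>.\<close>

lemma abs_ln_one_minus_square_le:
  fixes \<epsilon> :: real
  assumes "0 < \<epsilon>" "\<epsilon> < 1"
  shows "0 < \<bar>ln (1 - \<epsilon>\<^sup>2)\<bar>" "\<bar>ln (1 - \<epsilon>\<^sup>2)\<bar> \<le> - ln (1 - \<epsilon>)" "\<bar>ln (1 - \<epsilon>\<^sup>2)\<bar> \<le> 2 * (ln (1 - \<epsilon>))\<^sup>2"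
proof -
  have e2: "0 < \<epsilon>\<^sup>2" "\<epsilon>\<^sup>2 < 1" using assms by (auto simp: power_less_one_iff abs_square_less_1)
  then have neg: "ln (1 - \<epsilon>\<^sup>2) < 0" by simp
  then show "0 < \<bar>ln (1 - \<epsilon>\<^sup>2)\<bar>" by simp
  have "1 - \<epsilon>\<^sup>2 = (1 - \<epsilon>) * (1 + \<epsilon>)" by (simp add: power2_eq_square algebra_simps)
  also have "ln \<dots> = ln (1 - \<epsilon>) + ln (1 + \<epsilon>)" using assms by (intro ln_mult_pos) auto
  finally show le: "\<bar>ln (1 - \<epsilon>\<^sup>2)\<bar> \<le> - ln (1 - \<epsilon>)" using neg assms by simp
  have \<Lambda>: "\<epsilon> \<le> - ln (1 - \<epsilon>)" using ln_le_minus_one[of "1 - \<epsilon>"] assms by simp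
  show "\<bar>ln (1 - \<epsilon>\<^sup>2)\<bar> \<le> 2 * (ln (1 - \<epsilon>))\<^sup>2"
  proof (cases "\<epsilon> \<le> 1 / 2")
    case True
    have "1 - 1 / (1 - \<epsilon>\<^sup>2) \<le> ln (1 - \<epsilon>\<^sup>2)"
      using ln_le_minus_one[of "1 / (1 - \<epsilon>\<^sup>2)"] e2 by (simp add: ln_div)
    then have "\<bar>ln (1 - \<epsilon>\<^sup>2)\<bar> \<le> \<epsilon>\<^sup>2 / (1 - \<epsilon>\<^sup>2)" using neg e2 by (simp add: field_simps)
    also have "\<dots> \<le> \<epsilon>\<^sup>2 / (1 / 2)"
    proof (intro divide_left_mono)
      have "\<epsilon>\<^sup>2 \<le> (1 / 2)\<^sup>2" using True assms by (intro power_mono) auto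
      then show "1 / 2 \<le> 1 - \<epsilon>\<^sup>2" by (simp add: power2_eq_square)
    qed (use e2 in auto)
    also have "\<dots> \<le> 2 * (ln (1 - \<epsilon>))\<^sup>2"
      using power_mono[OF \<Lambda>, of 2] assms by simp
    finally show ?thesis .
  next
    case False
    then have "1 \<le> 2 * (- ln (1 - \<epsilon>))" using \<Lambda> by linarith
    from mult_right_mono[OF this, of "- ln (1 - \<epsilon>)"] \<Lambda> assms le show ?thesis
      by (simp add: power2_eq_square)
  qed
qed

lemma one_minus_powr_ge:
  fixes \<delta> q :: real
  assumes "0 < \<delta>" "\<delta> < 1" "0 < q"
  shows "1 / (1 - \<delta> powr q) \<le> 1 + 1 / (q * (- ln \<delta>))" "\<delta> powr q < 1"
proof -
  define x where "x = q * (- ln \<delta>)"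
  have x: "0 < x" unfolding x_def using assms by (intro mult_pos_pos) auto
  have \<delta>: "\<delta> powr q = exp (- x)" using assms by (simp add: powr_def x_def)
  then show "\<delta> powr q < 1" using x by simp
  have "exp (- x) \<le> 1 / (1 + x)"
    using exp_ge_add_one_self[of x] x by (simp add: exp_minus field_simps)
  then have "x / (1 + x) \<le> 1 - exp (- x)" using x by (simp add: field_simps)
  then have "1 / (1 - exp (- x)) \<le> 1 / (x / (1 + x))" using x by (intro divide_left_mono) auto
  also have "\<dots> = 1 + 1 / x" using x by (simp add: field_simps)
  finally show "1 / (1 - \<delta> powr q) \<le> 1 + 1 / (q * (- ln \<delta>))" by (simp add: \<delta> x_def)
qed

lemma exists_resolvent_parameter:
  fixes d :: "'a \<Rightarrow> real" and q \<kappa> F \<epsilon> :: real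
  assumes d: "\<And>i. i \<in> I \<Longrightarrow> 0 \<le> d i" and F: "F = sum d I" "0 < F"
    and q: "0 < q" and \<kappa>: "0 < \<kappa>" and \<epsilon>: "0 < \<epsilon>" "\<epsilon> < 1"
    and moment: "(\<Sum>i\<in>I. d i * (\<kappa> * d i / F) powr q) \<le> (1 - \<epsilon>) powr q * F"
  shows "\<exists>s>0. F / (81 * (1 + (q + 1) / (q * \<bar>ln (1 - \<epsilon>\<^sup>2)\<bar>))) \<le> s * ((\<Sum>i\<in>I. d i / (d i + s)) - \<kappa>)"
proof -
  \<comment> \<open>The pointwise inequality covers exponents up to one. A larger \<open>q\<close>
    is first reduced to the first moment by \<open>moment_one_le\<close>, without loss of a
    constant.\<close>
  define r where "r = min q 1"
  define \<delta> where "\<delta> = 1 - \<epsilon>"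
  define \<eta> where "\<eta> = (1 - \<delta> powr r) / r"
  \<comment> \<open>The largest value that both constraints of \<open>exists_resolvent_ge\<close>
    allow; which one binds decides the case in the estimate of
    \<open>1 / (\<theta> * \<eta> / 2)\<close>.\<close>
  define \<theta> where "\<theta> = min (r / 34) (\<eta> / 8)"
  define \<Lambda> L where "\<Lambda> = - ln \<delta>" and "L = \<bar>ln (1 - \<epsilon>\<^sup>2)\<bar>"
  define X where "X = 1 + (q + 1) / (q * L)"
  define Y where "Y = 1 / (r * L)"
  have r: "0 < r" "r \<le> 1" "r \<le> q" using q by (auto simp: r_def)
  have \<delta>: "0 < \<delta>" "\<delta> < 1" using \<epsilon> by (auto simp: \<delta>_def)
  have L: "0 < L" "L \<le> \<Lambda>" "L \<le> 2 * \<Lambda>\<^sup>2"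
    using abs_ln_one_minus_square_le[OF \<epsilon>] by (auto simp: L_def \<Lambda>_def \<delta>_def)
  have \<eta>: "0 < \<eta>" unfolding \<eta>_def using one_minus_powr_ge(2)[OF \<delta> r(1)] r by simp
  have \<theta>: "0 < \<theta>" "\<theta> \<le> r / 34" "\<theta> \<le> \<eta> / 8" using r \<eta> by (auto simp: \<theta>_def)
  have mom: "(\<Sum>i\<in>I. d i * (\<kappa> * d i / F) powr r) \<le> \<delta> powr r * F"
  proof (cases "q \<le> 1")
    case True
    then show ?thesis using moment by (simp add: r_def \<delta>_def)
  next
    case False
    have V: "0 \<le> \<kappa> * d i / F" if "i \<in> I" for i using d[OF that] \<kappa> F(2) by simp
    have "(\<Sum>i\<in>I. d i * (\<kappa> * d i / F)) \<le> \<delta> * F"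
      using moment_one_le[of I d "\<lambda>i. \<kappa> * d i / F" \<delta> q, OF d V \<delta>(1)] False moment
      unfolding F(1)[symmetric] \<delta>_def by linarith
    moreover have "(\<Sum>i\<in>I. d i * (\<kappa> * d i / F) powr 1) = (\<Sum>i\<in>I. d i * (\<kappa> * d i / F))"
      using d \<kappa> F(2) by (intro sum.cong) auto
    ultimately show ?thesis using False \<delta> by (simp add: r_def)
  qed
  have "1 - r * \<eta> = \<delta> powr r" using r by (simp add: \<eta>_def)
  then obtain s where s: "0 < s" "\<theta> * \<eta> / 2 * F \<le> s * ((\<Sum>i\<in>I. d i / (d i + s)) - \<kappa>)"
    using exists_resolvent_ge[OF d F r(1,2) \<kappa> _ \<theta>] mom by auto
  have rX: "1 + Y \<le> X"
  proof -
    have "1 / r \<le> (q + 1) / q" using q by (auto simp: r_def min_def field_simps)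
    then have "1 / r / L \<le> (q + 1) / q / L" using L by (intro divide_right_mono) auto
    then show ?thesis by (simp add: X_def Y_def)
  qed
  have Y: "0 \<le> Y" unfolding Y_def using r L by simp
  have r\<eta>: "1 / (r * \<eta>) \<le> 1 + 1 / (r * \<Lambda>)"
    using one_minus_powr_ge(1)[OF \<delta> r(1)] r by (simp add: \<eta>_def \<Lambda>_def)
  \<comment> \<open>The two cases give \<open>68 * (1 + Y)\<close> and \<open>32 + 64 * Y\<close>;
    \<open>81\<close> is a perfect square large enough for both.\<close>
  have "1 / (\<theta> * \<eta> / 2) \<le> 81 * X"
  proof (cases "r / 34 \<le> \<eta> / 8")
    case True
    then have "1 / (\<theta> * \<eta> / 2) = 68 * (1 / (r * \<eta>))" by (simp add: \<theta>_def)
    also have "\<dots> \<le> 68 * (1 + 1 / (r * \<Lambda>))" using r\<eta> by simp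
    also have "1 / (r * \<Lambda>) \<le> Y" unfolding Y_def using r L by (intro divide_left_mono mult_left_mono mult_pos_pos) auto
    finally have "1 / (\<theta> * \<eta> / 2) \<le> 68 * (1 + Y)" by simp
    also have "\<dots> \<le> 81 * (1 + Y)" using Y by simp
    also have "\<dots> \<le> 81 * X" using rX by simp
    finally show ?thesis .
  next
    case False
    then have "1 / (\<theta> * \<eta> / 2) = 16 * (r * (1 / (r * \<eta>)))\<^sup>2"
      using r by (simp add: \<theta>_def power2_eq_square)
    also have "\<dots> \<le> 16 * (r * (1 + 1 / (r * \<Lambda>)))\<^sup>2"
      using r\<eta> r \<eta> by (intro mult_left_mono power_mono) auto
    also have "r * (1 + 1 / (r * \<Lambda>)) = r + 1 / \<Lambda>" using r by (simp add: algebra_simps)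
    also have "(r + 1 / \<Lambda>)\<^sup>2 \<le> 2 * r\<^sup>2 + 2 * (1 / \<Lambda>)\<^sup>2"
      using sum_squares_bound[of r "1 / \<Lambda>"] by (simp add: power2_sum)
    also have "2 * r\<^sup>2 \<le> 2" using r by (simp add: power_le_one)
    also have "2 * (1 / \<Lambda>)\<^sup>2 \<le> 4 * (1 / L)"
      using L by (simp add: power_divide field_simps)
    also have "1 / L \<le> Y" unfolding Y_def using r L by (intro divide_left_mono) auto
    finally have "1 / (\<theta> * \<eta> / 2) \<le> 32 + 64 * (Y)" by simp
    also have "\<dots> \<le> 81 * (1 + Y)" using Y by simp
    also have "\<dots> \<le> 81 * X" using rX by simp
    finally show ?thesis .
  qed
  moreover have "0 < X" unfolding X_def using q L by (simp add: add_pos_pos)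
  ultimately have "1 / (81 * X) \<le> \<theta> * \<eta> / 2"
    using \<theta> \<eta> by (simp add: field_simps)
  from mult_right_mono[OF this, of F] F(2) have "F / (81 * X) \<le> \<theta> * \<eta> / 2 * F" by simp
  from order_trans[OF this s(2)] s(1) show ?thesis unfolding X_def L_def by blast
qed

section \<open>Restricted invertibility for the stable rank\<close>

lemma schatten_norm_eq:
  fixes A :: "real mat" and m :: nat
  assumes "mset (singular_values A) = image_mset (\<lambda>i. sqrt (d i)) (mset_set {..<m})"
    and d: "\<forall>i<m. 0 \<le> d i"
  shows "schatten_norm p A = (\<Sum>i<m. d i powr (p / 2)) powr (1 / p)"
proof -
  have "(\<Sum>s\<leftarrow>singular_values A. s powr p) = (\<Sum>s\<in>#mset (singular_values A). s powr p)"
    by (metis mset_map sum_mset_sum_list)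
  also have "\<dots> = (\<Sum>i<m. sqrt (d i) powr p)" unfolding assms(1)
    by (simp add: sum_unfold_sum_mset multiset.map_comp comp_def)
  also have "\<dots> = (\<Sum>i<m. d i powr (p / 2))"
    using d by (intro sum.cong) (auto simp: powr_half_sqrt[symmetric] powr_powr)
  finally show ?thesis by (simp add: schatten_norm_def)
qed

text \<open>For this \<open>q\<close> the definition unfolds to
  \<open>srank p A powr q = F powr (q + 1) / S\<close>, with \<open>S\<close> the sum of the
  \<open>d i powr (q + 1)\<close>. An upper bound for \<open>\<kappa> / srank p A\<close> is
  therefore exactly a moment bound.\<close>

lemma sum_powr_eq_srank:
  fixes A :: "real mat" and m :: nat
  assumes mset: "mset (singular_values A) = image_mset (\<lambda>i. sqrt (d i)) (mset_set {..<m})"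
    and d: "\<forall>i<m. 0 \<le> d i" "\<exists>i<m. 0 < d i" and p: "2 < p"
    and F: "F = (\<Sum>i<m. d i)" and q: "q = (p - 2) / 2" and \<kappa>: "0 < \<kappa>"
  shows "(\<Sum>i<m. d i * (\<kappa> * d i / F) powr q) = (\<kappa> / srank p A) powr q * F" "0 < srank p A"
    "schatten_norm 2 A = sqrt F" "0 < F"
proof -
  define S where "S = (\<Sum>i<m. d i powr (q + 1))"
  obtain j where j: "j < m" "0 < d j" using d(2) by blast
  show Fp: "0 < F" unfolding F using d(1) j by (intro sum_pos2[of _ j]) auto
  have Sp: "0 < S" unfolding S_def using j by (intro sum_pos2[of _ j]) auto
  have q0: "0 < q" using p q by simp
  have pq: "p = 2 * q + 2" using q by simp
  have s2: "schatten_norm 2 A = F powr (1 / 2)"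
  proof -
    have "(\<Sum>i<m. d i powr (2 / 2)) = F" unfolding F using d(1) by (intro sum.cong) auto
    then show ?thesis unfolding schatten_norm_eq[OF mset d(1)] by simp
  qed
  then show "schatten_norm 2 A = sqrt F" using Fp by (simp add: powr_half_sqrt)
  have sp: "schatten_norm p A = S powr (1 / (2 * q + 2))"
    unfolding schatten_norm_eq[OF mset d(1)] S_def pq by (simp add: add_divide_distrib)
  have sr: "srank p A = F powr ((q + 1) / q) / S powr (1 / q)"
  proof -
    have "srank p A = (F powr (1 / 2)) powr ((2 * q + 2) / q) / (S powr (1 / (2 * q + 2))) powr ((2 * q + 2) / q)"
    proof -
      have "2 * p / (p - 2) = (2 * q + 2) / q" unfolding pq using q0 by (simp add: field_simps)
      then show ?thesis unfolding srank_def s2 sp by (simp add: powr_divide)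
    qed
    also have "(F powr (1 / 2)) powr ((2 * q + 2) / q) = F powr ((q + 1) / q)"
      unfolding powr_powr by (simp add: add_divide_distrib)
    also have "(S powr (1 / (2 * q + 2))) powr ((2 * q + 2) / q) = S powr (1 / q)"
      unfolding powr_powr using q0 by simp
    finally show ?thesis .
  qed
  then show "0 < srank p A" using Fp Sp by simp
  have srq: "srank p A powr q = F powr (q + 1) / S"
    unfolding sr using q0 Sp Fp by (simp add: powr_divide powr_powr)
  have "(\<Sum>i<m. d i * (\<kappa> * d i / F) powr q) = (\<Sum>i<m. \<kappa> powr q / F powr q * d i powr (q + 1))"
  proof (intro sum.cong refl)
    fix i assume "i \<in> {..<m}"
    then have "0 \<le> d i" using d(1) by simp
    then show "d i * (\<kappa> * d i / F) powr q = \<kappa> powr q / F powr q * d i powr (q + 1)"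
      using \<kappa> Fp by (cases "d i = 0") (simp_all add: powr_divide powr_mult powr_add)
  qed
  also have "\<dots> = \<kappa> powr q / F powr q * S" by (simp add: S_def sum_distrib_left)
  also have "\<dots> = \<kappa> powr q / srank p A powr q * F"
    unfolding srq using Fp Sp by (simp add: powr_add)
  also have "\<dots> = (\<kappa> / srank p A) powr q * F"
    using \<kappa> \<open>0 < srank p A\<close> by (simp add: powr_divide)
  finally show "(\<Sum>i<m. d i * (\<kappa> * d i / F) powr q) = (\<kappa> / srank p A) powr q * F" .
qed

text \<open>The rank hypothesis is the moment bound with \<open>\<kappa> = k\<close>. The resulting
  parameter \<open>s\<close> makes \<open>c\<close> at least \<open>F / (81 * X) / m\<close>, so
  \<open>9\<close> arises as the square root of \<open>81\<close>.\<close>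

lemma restricted_invertibility_srank:
  fixes A :: "real mat"
  assumes k: "1 \<le> k" and \<epsilon>: "0 < \<epsilon>" "\<epsilon> < 1" and p: "2 < p"
    and A: "A \<in> carrier_mat n m" "A \<noteq> 0\<^sub>m n m" and le: "real k \<le> (1 - \<epsilon>) * srank p A"
  shows "\<exists>\<sigma>. \<sigma> \<subseteq> {..<m} \<and> card \<sigma> = k \<and> inv_restrict_norm A \<sigma> \<le>
    ereal (9 * sqrt (1 + p / ((p - 2) * \<bar>ln (1 - \<epsilon>\<^sup>2)\<bar>)) * (sqrt (real m) / schatten_norm 2 A))"
proof -
  obtain Q d where Q: "Q \<in> carrier_mat m m" "Q\<^sup>T * Q = 1\<^sub>m m" "A\<^sup>T * A = Q * mat_diag m d * Q\<^sup>T"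
    and d: "\<And>i. i < m \<Longrightarrow> 0 \<le> d i"
    and mset: "mset (singular_values A) = image_mset (\<lambda>i. sqrt (d i)) (mset_set {..<m})"
    and pos: "\<exists>i<m. 0 < d i"
    using gram_eigenvalues[OF A(1)] A(2) by metis
  have d': "\<forall>i<m. 0 \<le> d i" using d by blast
  define F q where "F = (\<Sum>i<m. d i)" and "q = (p - 2) / 2"
  have \<kappa>: "0 < real k" using k by simp
  note sr = sum_powr_eq_srank[OF mset d' pos p F_def q_def \<kappa>]
  have q: "0 < q" using p by (simp add: q_def)
  have "real k / srank p A \<le> 1 - \<epsilon>" using le sr(2) by (simp add: divide_le_eq)
  then have "(real k / srank p A) powr q * F \<le> (1 - \<epsilon>) powr q * F"
    using \<kappa> sr(2,4) q by (intro mult_right_mono powr_mono2) auto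
  then have mom: "(\<Sum>i<m. d i * (real k * d i / F) powr q) \<le> (1 - \<epsilon>) powr q * F" by (simp add: sr(1))
  define X where "X = 1 + p / ((p - 2) * \<bar>ln (1 - \<epsilon>\<^sup>2)\<bar>)"
  have "(q + 1) / q = p / (p - 2)" using p by (simp add: q_def field_simps)
  then have "(q + 1) / (q * \<bar>ln (1 - \<epsilon>\<^sup>2)\<bar>) = p / ((p - 2) * \<bar>ln (1 - \<epsilon>\<^sup>2)\<bar>)"
    by (metis divide_divide_eq_left)
  then obtain s where s: "0 < s" "F / (81 * X) \<le> s * ((\<Sum>i<m. d i / (d i + s)) - real k)"
    using exists_resolvent_parameter[OF _ F_def sr(4) q \<kappa> \<epsilon> mom] d unfolding X_def by auto
  have X: "0 < X" unfolding X_def using p abs_ln_one_minus_square_le(1)[OF \<epsilon>] by (simp add: add_pos_pos)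
  have "0 < F / (81 * X)" using X sr(4) by simp
  then have "0 < s * ((\<Sum>i<m. d i / (d i + s)) - real k)" using s(2) by linarith
  then have kN: "real k < (\<Sum>i<m. d i / (d i + s))" using s(1) by (simp add: zero_less_mult_iff)
  have m: "0 < m" using pos by (metis gr_implies_not0 gr0I)
  define c where "c = s * ((\<Sum>i<m. d i / (d i + s)) - real k) / real m"
  obtain \<sigma> where \<sigma>: "\<sigma> \<subseteq> {..<m}" "card \<sigma> = k" "inv_restrict_norm A \<sigma> \<le> ereal (1 / sqrt c)"
    using restricted_invertibility_resolvent[OF A(1) Q d s(1) _ kN] k unfolding c_def by auto
  have c0: "0 < c" unfolding c_def using s(1) kN m by simp
  have "F / (81 * X) / real m \<le> c" unfolding c_def using s(2) by (intro divide_right_mono) auto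
  then have "1 / sqrt c \<le> 1 / sqrt (F / (81 * X) / real m)"
    using X m sr(4) c0 by (intro divide_left_mono real_sqrt_le_mono mult_pos_pos) auto
  also have "\<dots> = 9 * sqrt X * (sqrt (real m) / sqrt F)"
    by (simp add: real_sqrt_divide real_sqrt_mult)
  finally have "inv_restrict_norm A \<sigma> \<le> ereal (9 * sqrt X * (sqrt (real m) / schatten_norm 2 A))"
    using \<sigma>(3) sr(3) by (metis ereal_less_eq(3) order_trans)
  then show ?thesis using \<sigma> unfolding X_def by blast
qed

text \<open>In each branch \<open>1 + P / L\<close> is at most \<open>9\<close> times the square of
  \<open>psi p \<epsilon>\<close>. The first branch uses \<open>\<epsilon>\<^sup>2 \<le> L\<close>,
  the others \<open>\<Lambda> \<le> 4 * L\<close>; the last two are separated by whether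
  \<open>\<Lambda>\<close> exceeds \<open>P\<close>.\<close>

lemma sqrt_le_psi:
  fixes p \<epsilon> :: real
  assumes p: "2 < p" and \<epsilon>: "0 < \<epsilon>" "\<epsilon> < 1"
  shows "ereal (sqrt (1 + p / ((p - 2) * \<bar>ln (1 - \<epsilon>\<^sup>2)\<bar>))) \<le> ereal 3 * psi p \<epsilon>"
proof -
  define P L \<Lambda> where "P = p / (p - 2)" and "L = \<bar>ln (1 - \<epsilon>\<^sup>2)\<bar>" and "\<Lambda> = - ln (1 - \<epsilon>)"
  have P: "1 \<le> P" unfolding P_def using p by simp
  have L: "0 < L" using abs_ln_one_minus_square_le[OF \<epsilon>] by (simp add: L_def)
  have e2: "\<epsilon>\<^sup>2 < 1" using \<epsilon> by (simp add: power_less_one_iff abs_square_less_1)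
  have Lln: "L = - ln (1 - \<epsilon>\<^sup>2)" unfolding L_def using e2 \<epsilon> by simp
  have PL: "p / ((p - 2) * \<bar>ln (1 - \<epsilon>\<^sup>2)\<bar>) = P / L" by (simp add: P_def L_def)
  \<comment> \<open>Exponentiated, this is
    \<open>(1 - \<epsilon>\<^sup>2) ^ 4 \<le> 1 - \<epsilon>\<close>. One factor splits as
    \<open>(1 + \<epsilon>) * (1 - \<epsilon>)\<close>, and from \<open>1 / 2\<close> on the rest is
    at most \<open>27 / 32\<close>.\<close>
  have L\<Lambda>: "\<Lambda> \<le> 4 * L" if e: "1 / 2 \<le> \<epsilon>"
  proof -
    have "(1 - \<epsilon>\<^sup>2) ^ 3 * (1 + \<epsilon>) \<le> (3 / 4) ^ 3 * 2"
    proof (intro mult_mono power_mono)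
      have "(1 / 2)\<^sup>2 \<le> \<epsilon>\<^sup>2" using e by (intro power_mono) auto
      then show "1 - \<epsilon>\<^sup>2 \<le> 3 / 4" by (simp add: power2_eq_square)
    qed (use \<epsilon> e2 in auto)
    also have "\<dots> \<le> (1::real)" by (simp add: eval_nat_numeral)
    finally have "(1 - \<epsilon>\<^sup>2) ^ 3 * (1 + \<epsilon>) * (1 - \<epsilon>) \<le> 1 * (1 - \<epsilon>)" using \<epsilon> by (intro mult_right_mono) auto
    moreover have "(1 - \<epsilon>\<^sup>2) ^ 4 = (1 - \<epsilon>\<^sup>2) ^ 3 * (1 + \<epsilon>) * (1 - \<epsilon>)"
      by (simp add: power2_eq_square eval_nat_numeral algebra_simps)
    ultimately have "ln ((1 - \<epsilon>\<^sup>2) ^ 4) \<le> ln (1 - \<epsilon>)" using e2 \<epsilon> by simp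
    then show ?thesis using e2 by (simp add: Lln \<Lambda>_def ln_realpow)
  qed
  consider "\<epsilon> \<le> 1 / 2" | "1 / 2 < \<epsilon>" "\<epsilon> \<le> 1 - exp (- P)" | "1 / 2 < \<epsilon>" "1 - exp (- P) < \<epsilon>" by linarith
  then have "\<exists>y. psi p \<epsilon> = ereal y \<and> sqrt (1 + P / L) \<le> 3 * y"
  proof cases
    case 1
    have "\<epsilon>\<^sup>2 \<le> L" using ln_le_minus_one[of "1 - \<epsilon>\<^sup>2"] e2 Lln by simp
    then have "P / L \<le> P / \<epsilon>\<^sup>2" using P \<epsilon> L by (intro divide_left_mono) auto
    moreover have "1 \<le> P / \<epsilon>\<^sup>2" using P e2 \<epsilon> by (simp add: le_divide_eq)
    ultimately have "1 + P / L \<le> 9 * (P / \<epsilon>\<^sup>2)" by linarith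
    then have "sqrt (1 + P / L) \<le> sqrt (9 * (P / \<epsilon>\<^sup>2))" by (rule real_sqrt_le_mono)
    also have "\<dots> = 3 * (1 / \<epsilon> * sqrt P)" using \<epsilon> by (simp add: real_sqrt_mult real_sqrt_divide)
    finally show ?thesis using 1 \<epsilon> by (auto simp: psi_def P_def)
  next
    case 2
    have "exp (- P) \<le> 1 - \<epsilon>" using 2 by linarith
    then have "\<Lambda> \<le> P" unfolding \<Lambda>_def using \<epsilon> ln_ge_iff[of "1 - \<epsilon>" "- P"] by linarith
    moreover have \<Lambda>: "0 < \<Lambda>" unfolding \<Lambda>_def using \<epsilon> by simp
    ultimately have "1 \<le> P / \<Lambda>" by simp
    moreover have "P / L \<le> P / (\<Lambda> / 4)" using P L \<Lambda> L\<Lambda> 2 by (intro divide_left_mono) auto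
    ultimately have "1 + P / L \<le> 9 * (P / \<Lambda>)" by simp
    then have "sqrt (1 + P / L) \<le> sqrt (9 * (P / \<Lambda>))" by (rule real_sqrt_le_mono)
    also have "\<dots> = 3 * (1 / sqrt (ln (1 / (1 - \<epsilon>))) * sqrt P)"
    proof -
      have "ln (1 / (1 - \<epsilon>)) = \<Lambda>" using \<epsilon> by (simp add: \<Lambda>_def ln_div)
      then show ?thesis by (simp add: real_sqrt_mult real_sqrt_divide)
    qed
    finally show ?thesis using 2 \<epsilon> by (auto simp: psi_def P_def)
  next
    case 3
    have "1 - \<epsilon> < exp (- P)" using 3 by linarith
    then have "ln (1 - \<epsilon>) < - P" using \<epsilon> by (metis diff_gt_0_iff_gt exp_gt_zero ln_exp ln_less_cancel_iff)
    then have "P / L \<le> 4" using L\<Lambda> 3 L by (simp add: \<Lambda>_def divide_le_eq)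
    then have "sqrt (1 + P / L) \<le> sqrt 9" by (intro real_sqrt_le_mono) simp
    then show ?thesis using 3 \<epsilon> by (auto simp: psi_def P_def one_ereal_def)
  qed
  then show ?thesis unfolding PL by auto
qed

text \<open>A minimiser of the norm over the finitely many \<open>k\<close>-subsets does at least as
  well as the set found for any single \<open>p\<close>, so it serves the whole infimum. The
  constant is \<open>27 = 9 * 3\<close>, from \<open>restricted_invertibility_srank\<close> and
  \<open>sqrt_le_psi\<close>.\<close>

lemma restricted_invertibility_entrank:
  fixes A :: "real mat"
  assumes k: "1 \<le> k" and A: "A \<in> carrier_mat n m" "A \<noteq> 0\<^sub>m n m" and ent: "real k < entrank A"
  shows "\<exists>\<sigma>. \<sigma> \<subseteq> {..<m} \<and> card \<sigma> = k \<and> inv_restrict_norm A \<sigma> \<le>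
    ereal 27 * (INF p\<in>{2<..}. psi p (1 - real k / srank p A)) * ereal (sqrt (real m) / schatten_norm 2 A)"
proof -
  obtain Q d where d: "\<And>i. i < m \<Longrightarrow> 0 \<le> d i"
    and mset: "mset (singular_values A) = image_mset (\<lambda>i. sqrt (d i)) (mset_set {..<m})"
    and pos: "\<exists>i<m. 0 < d i"
    using gram_eigenvalues[OF A(1)] A(2) by metis
  have d': "\<forall>i<m. 0 \<le> d i" using d by blast
  have \<kappa>: "0 < real k" using k by simp
  note sr = sum_powr_eq_srank[OF mset d' pos _ refl refl \<kappa>]
  have m: "0 < m" using pos by (metis gr_implies_not0 gr0I)
  define c where "c = 27 * (sqrt (real m) / schatten_norm 2 A)"
  have c: "0 < c" unfolding c_def using sr(3,4)[of 3] m by simp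
  have subset_for_p: "\<exists>\<sigma>. \<sigma> \<subseteq> {..<m} \<and> card \<sigma> = k \<and> inv_restrict_norm A \<sigma> \<le> ereal c * psi p (1 - real k / srank p A)"
    if p: "2 < p" and lt: "real k < srank p A" for p
  proof -
    define \<epsilon> where "\<epsilon> = 1 - real k / srank p A"
    have sp: "0 < srank p A" by (rule sr(2)[OF p])
    have \<epsilon>: "0 < \<epsilon>" "\<epsilon> < 1" unfolding \<epsilon>_def using sp lt \<kappa> by auto
    have "real k \<le> (1 - \<epsilon>) * srank p A" unfolding \<epsilon>_def using sp by simp
    from restricted_invertibility_srank[OF k \<epsilon> p A this] obtain \<sigma> where
      \<sigma>: "\<sigma> \<subseteq> {..<m}" "card \<sigma> = k" "inv_restrict_norm A \<sigma> \<le>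
        ereal (9 * sqrt (1 + p / ((p - 2) * \<bar>ln (1 - \<epsilon>\<^sup>2)\<bar>)) * (sqrt (real m) / schatten_norm 2 A))" by blast
    note \<sigma>(3)
    also have "ereal (9 * sqrt (1 + p / ((p - 2) * \<bar>ln (1 - \<epsilon>\<^sup>2)\<bar>)) * (sqrt (real m) / schatten_norm 2 A)) =
        ereal (c / 3) * ereal (sqrt (1 + p / ((p - 2) * \<bar>ln (1 - \<epsilon>\<^sup>2)\<bar>)))"
      by (simp add: c_def)
    also have "\<dots> \<le> ereal (c / 3) * (ereal 3 * psi p \<epsilon>)"
      using c by (intro ereal_mult_left_mono sqrt_le_psi[OF p \<epsilon>]) auto
    also have "\<dots> = ereal c * psi p \<epsilon>" by (simp flip: mult.assoc)
    finally show ?thesis using \<sigma> unfolding \<epsilon>_def by blast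
  qed
  define S where "S = {\<sigma>. \<sigma> \<subseteq> {..<m} \<and> card \<sigma> = k}"
  have finS: "finite S" unfolding S_def by simp
  \<comment> \<open>This amounts to \<open>k \<le> m\<close>. Since the stable ranks converge to
    \<open>entrank A\<close>, some \<open>p\<close> close to \<open>2\<close> has
    \<open>srank p A > k\<close>, and the subset found for it is a witness.\<close>
  have neS: "S \<noteq> {}"
  proof -
    obtain j where j: "j < m" "0 < d j" using pos by blast
    then have "sqrt (d j) \<in># mset (singular_values A)" unfolding mset by (auto intro!: image_eqI[of _ _ j])
    then have ex: "\<exists>s\<in>set (singular_values A). s \<noteq> 0" using j by (intro bexI[of _ "sqrt (d j)"]) auto
    have "((\<lambda>p. srank p A) \<longlongrightarrow> entrank A) (at_right 2)"
      unfolding entrank_formula[OF ex] by (rule srank_tendsto_entrank_formula[OF ex])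
    then have "eventually (\<lambda>p. real k < srank p A) (at_right 2)" using ent by (rule order_tendstoD)
    then obtain b where "2 < b" "\<And>p. 2 < p \<Longrightarrow> p < b \<Longrightarrow> real k < srank p A"
      unfolding eventually_at_right_field by blast
    then obtain p where "2 < p" "real k < srank p A" using dense by blast
    from subset_for_p[OF this] show ?thesis unfolding S_def by blast
  qed
  obtain \<sigma> where \<sigma>: "\<sigma> \<in> S" and min: "\<And>\<tau>. \<tau> \<in> S \<Longrightarrow> inv_restrict_norm A \<sigma> \<le> inv_restrict_norm A \<tau>"
    using ex_is_arg_min_if_finite[OF finS neS, of "inv_restrict_norm A"]
    by (auto simp: is_arg_min_linorder)
  \<comment> \<open>With the constant on the left the infimum can be tested at each \<open>p\<close>
    separately; those with \<open>srank p A \<le> k\<close> contribute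
    \<open>\<infinity>\<close>.\<close>
  have "inv_restrict_norm A \<sigma> / ereal c \<le> (INF p\<in>{2<..}. psi p (1 - real k / srank p A))"
  proof (rule INF_greatest)
    fix p :: real assume "p \<in> {2<..}"
    then have p: "2 < p" by simp
    show "inv_restrict_norm A \<sigma> / ereal c \<le> psi p (1 - real k / srank p A)"
    proof (cases "real k < srank p A")
      case True
      obtain \<tau> where "\<tau> \<in> S" "inv_restrict_norm A \<tau> \<le> ereal c * psi p (1 - real k / srank p A)"
        using subset_for_p[OF p True] unfolding S_def by blast
      then have "inv_restrict_norm A \<sigma> \<le> ereal c * psi p (1 - real k / srank p A)"
        using min order_trans by blast
      then show ?thesis using c by (simp add: ereal_divide_le_pos)
    next
      case False
      then have "1 - real k / srank p A \<le> 0" using sr(2)[OF p] by simp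
      then show ?thesis by (simp add: psi_def)
    qed
  qed
  then have "inv_restrict_norm A \<sigma> \<le> ereal c * (INF p\<in>{2<..}. psi p (1 - real k / srank p A))"
    using c by (simp add: ereal_divide_le_pos)
  moreover have "ereal c = ereal 27 * ereal (sqrt (real m) / schatten_norm 2 A)" by (simp add: c_def)
  ultimately have "inv_restrict_norm A \<sigma> \<le> ereal 27 *
      (INF p\<in>{2<..}. psi p (1 - real k / srank p A)) * ereal (sqrt (real m) / schatten_norm 2 A)"
    by (simp only: ac_simps)
  then show ?thesis using \<sigma> unfolding S_def by blast
qed

theorem theorem8:
  shows "(\<exists>C::real. 0 < C \<and>
      (\<forall>(k::nat) (m::nat) (n::nat) (\<epsilon>::real) (p::real) (A::real mat).
         1 \<le> k \<longrightarrow> 1 \<le> m \<longrightarrow> 1 \<le> n \<longrightarrow> 0 < \<epsilon> \<longrightarrow> \<epsilon> < 1 \<longrightarrow> 2 < p \<longrightarrow>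
         A \<in> carrier_mat n m \<longrightarrow> A \<noteq> 0\<^sub>m n m \<longrightarrow>
         real k \<le> (1 - \<epsilon>) * srank p A \<longrightarrow>
         (\<exists>\<sigma>. \<sigma> \<subseteq> {..<m} \<and> card \<sigma> = k \<and>
            inv_restrict_norm A \<sigma> \<le>
              ereal (C * sqrt (1 + p / ((p - 2) * \<bar>ln (1 - \<epsilon>\<^sup>2)\<bar>))
                     * (sqrt (real m) / schatten_norm 2 A)))))
    \<and> (\<exists>C'::real. 0 < C' \<and>
      (\<forall>(k::nat) (m::nat) (n::nat) (A::real mat).
         1 \<le> k \<longrightarrow> 1 \<le> m \<longrightarrow> 1 \<le> n \<longrightarrow>
         A \<in> carrier_mat n m \<longrightarrow> A \<noteq> 0\<^sub>m n m \<longrightarrow>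
         real k < entrank A \<longrightarrow>
         (\<exists>\<sigma>. \<sigma> \<subseteq> {..<m} \<and> card \<sigma> = k \<and>
            inv_restrict_norm A \<sigma> \<le>
              ereal C' * (INF p\<in>{2<..}. psi p (1 - real k / srank p A))
                     * ereal (sqrt (real m) / schatten_norm 2 A))))"
proof (rule conjI, goal_cases)
  case 1
  show ?case using restricted_invertibility_srank by (intro exI[of _ 9]) simp
next
  case 2
  show ?case using restricted_invertibility_entrank by (intro exI[of _ 27]) simp
qed

end
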